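(* Let $0<a\leq 1$, let $N\geq 1$ be an integer, $m\in\{1,\ldots,N\}$, $k\in\{1,\ldots,m+1\}$. Then $$F_N^{m,k}(a)=F_N(a)\,\det\left(1-1_{\mathbb Z\cap[k,+\infty)}K_{N,m}\right)_{\ell^2(\mathbb Z)},$$ where $$K_{N,m}(n,n')=\frac{1}{(2\pi i)^2}\int_{\Sigma_2}du\int_{\Sigma_1}dv\,\frac{u^{-n-1}v^{n'}}{u-v}\,\frac{W(v)}{W(u)},\qquad n,n'\in\mathbb Z,$$ $\Sigma_1$ is a simple closed contour around $a$ but not enclosing $-1/a$, $\Sigma_2$ is a simple closed contour around $\Sigma_1$ and $0$, both oriented positively, and $$W(z)=\frac{z^{N-m}}{(z-a)^{N-m+1}(1+az)^m}.$$
   Context: For integers $i,l$ let $S_{i,l}=[i,i+1]\times[l,l+1]\subset\mathbb R^2$. The Aztec diamond $A_N$ is the union of all $S_{i,l}$ contained in $\{|x|+|y|\leq N+1\}$. The reduced Aztec diamond $A_N^{m,k}$ is the union of all $S_{i,l}$ contained in $$\{(x,y)\in\mathbb R^2:\ |x|+|y|\leq N+1\ \text{ and }\ y\leq\max\{2m-1-N-x,\ x-2m-1+N+2k\}\}.$$ A domino is a rectangle $[i,i+1]\times[l,l+2]$ (vertical) or $[i,i+2]\times[l,l+1]$ (horizontal), $i,l\in\mathbb Z$. A domino tiling of a region is a collection of dominoes contained in the region, with disjoint interiors, whose union is the region. For a tiling $T$, $v(T)$ is its number of vertical dominoes; $F_N(a)=\sum_{T}a^{v(T)}$ with sum over all domino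 tilings of $A_N$, and $F_N^{m,k}(a)=\sum_{T}a^{v(T)}$ with sum over all domino tilings of $A_N^{m,k}$. (It is known that $F_N(a)=(1+a^2)^{N(N+1)/2}$.) $1_{\mathbb Z\cap[k,+\infty)}$ is the projection onto sequences supported on $\{k,k+1,\ldots\}$, and the Fredholm determinant on $\ell^2(\mathbb Z)$ is given by the Fredholm series $$\det(1-1_{\mathbb Z\cap[k,+\infty)}K)_{\ell^2(\mathbb Z)}=1+\sum_{p=1}^\infty\frac{(-1)^p}{p!}\sum_{n_1,\ldots,n_p\geq k}\det\left(K(n_i,n_j)\right)_{i,j=1}^p .$$ *)

theory Defs
  imports "HOL-Complex_Analysis.Complex_Analysis" "Jordan_Normal_Form.Determinant"
begin

section \<open>Aztec diamonds and domino tilings\<close>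

type_synonym region = "(real \<times> real) set"

definition unit_square :: "int \<Rightarrow> int \<Rightarrow> region" where
  "unit_square i l = {real_of_int i .. real_of_int i + 1} \<times> {real_of_int l .. real_of_int l + 1}"

definition squares_within :: "region \<Rightarrow> region" where
  "squares_within B = \<Union> {S. (\<exists>i l. S = unit_square i l) \<and> S \<subseteq> B}"

definition aztec_diamond :: "nat \<Rightarrow> region" where
  "aztec_diamond N = squares_within {(x, y). \<bar>x\<bar> + \<bar>y\<bar> \<le> real N + 1}"

definition reduced_aztec_diamond :: "nat \<Rightarrow> nat \<Rightarrow> nat \<Rightarrow> region" where
  "reduced_aztec_diamond N m k = squares_within
     {(x, y). \<bar>x\<bar> + \<bar>y\<bar> \<le> real N + 1 \<and>
              y \<le> max (2 * real m - 1 - real N - x) (x - 2 * real m - 1 + real N + 2 * real k)}"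

definition vertical_domino :: "region \<Rightarrow> bool" where
  "vertical_domino D \<longleftrightarrow>
     (\<exists>i l::int. D = {real_of_int i .. real_of_int i + 1} \<times> {real_of_int l .. real_of_int l + 2})"

definition horizontal_domino :: "region \<Rightarrow> bool" where
  "horizontal_domino D \<longleftrightarrow>
     (\<exists>i l::int. D = {real_of_int i .. real_of_int i + 2} \<times> {real_of_int l .. real_of_int l + 1})"

definition domino_tilings :: "region \<Rightarrow> region set set" where
  "domino_tilings R =
     {T. (\<forall>D\<in>T. (vertical_domino D \<or> horizontal_domino D) \<and> D \<subseteq> R) \<and>
         pairwise (\<lambda>D E. interior D \<inter> interior E = {}) T \<and>
         \<Union> T = R}"

definition num_vertical :: "region set \<Rightarrow> nat" where
  "num_vertical T = card {D \<in> T. vertical_domino D}"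

definition tiling_sum :: "region \<Rightarrow> real \<Rightarrow> real" where
  "tiling_sum R a = (\<Sum>T\<in>domino_tilings R. a ^ num_vertical T)"

definition F_aztec :: "nat \<Rightarrow> real \<Rightarrow> real" where
  "F_aztec N a = tiling_sum (aztec_diamond N) a"

definition F_reduced :: "nat \<Rightarrow> nat \<Rightarrow> nat \<Rightarrow> real \<Rightarrow> real" where
  "F_reduced N m k a = tiling_sum (reduced_aztec_diamond N m k) a"


section \<open>The kernel\<close>

definition positive_contour :: "(real \<Rightarrow> complex) \<Rightarrow> bool" where
  "positive_contour g \<longleftrightarrow>
     valid_path g \<and> simple_path g \<and> pathfinish g = pathstart g \<and>
     (\<forall>z \<in> inside (path_image g). winding_number g z = 1)"

definition W :: "real \<Rightarrow> nat \<Rightarrow> nat \<Rightarrow> complex \<Rightarrow> complex" where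
  "W a N m z = z ^ (N - m) /
     ((z - complex_of_real a) ^ (N - m + 1) * (1 + complex_of_real a * z) ^ m)"

definition K_aztec ::
  "real \<Rightarrow> nat \<Rightarrow> nat \<Rightarrow> (real \<Rightarrow> complex) \<Rightarrow> (real \<Rightarrow> complex) \<Rightarrow> int \<Rightarrow> int \<Rightarrow> complex" where
  "K_aztec a N m \<Sigma>\<^sub>1 \<Sigma>\<^sub>2 n n' =
     1 / (2 * complex_of_real pi * \<i>) ^ 2 *
     contour_integral \<Sigma>\<^sub>2 (\<lambda>u. contour_integral \<Sigma>\<^sub>1 (\<lambda>v.
       (u powi (- n - 1) * v powi n') / (u - v) * (W a N m v / W a N m u)))"


section \<open>Fredholm determinants on sequences supported on the integers from k on\<close>

definition fredholm_minor :: "(int \<Rightarrow> int \<Rightarrow> complex) \<Rightarrow> nat \<Rightarrow> (nat \<Rightarrow> int) \<Rightarrow> complex" where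
  "fredholm_minor K p ns = Determinant.det (Matrix.mat p p (\<lambda>(i, j). K (ns i) (ns j)))"

text \<open>The tuples \<open>n\<^sub>1, \<dots>, n\<^sub>p \<ge> k\<close> are the functions in \<open>{0..<p} \<rightarrow>\<^sub>E {k..}\<close>, and the
  sum over \<open>p \<ge> 1\<close> is reindexed by \<open>p = Suc q\<close>.\<close>

definition fredholm_term :: "(int \<Rightarrow> int \<Rightarrow> complex) \<Rightarrow> int \<Rightarrow> nat \<Rightarrow> complex" where
  "fredholm_term K k p =
     (-1) ^ p / fact p * (\<Sum>\<^sub>\<infinity>ns\<in>{0..<p} \<rightarrow>\<^sub>E {k..}. fredholm_minor K p ns)"

definition fredholm_det :: "(int \<Rightarrow> int \<Rightarrow> complex) \<Rightarrow> int \<Rightarrow> complex" where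
  "fredholm_det K k = 1 + (\<Sum>q. fredholm_term K k (Suc q))"

text \<open>Both infinite sums default to \<open>0\<close> when they diverge, so the existence of the Fredholm
  determinant has to be expressed separately.\<close>

definition fredholm_convergent :: "(int \<Rightarrow> int \<Rightarrow> complex) \<Rightarrow> int \<Rightarrow> bool" where
  "fredholm_convergent K k \<longleftrightarrow>
     (\<forall>p\<ge>1. fredholm_minor K p summable_on ({0..<p} \<rightarrow>\<^sub>E {k..})) \<and>
     summable (\<lambda>q. fredholm_term K k (Suc q))"

end

theory Submission
  imports Defs
begin

text \<open>Matching each square of one colour with its partner turns a tiling of \<open>A\<^sub>N\<close> into a
  permutation, and the tiling sum into the determinant of a signed adjacency (Kasteleyn) matrix.
  Ordering the squares diagonal by diagonal makes the sign of such a permutation a product of local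
  signs, because an inversion always pairs a square matched forwards with one matched backwards.

  In a tiling of the full diamond that matches the squares of the first cut diagonal by horizontal
  dominoes, the whole removed region is forced to be horizontal. Hence \<open>F\<^sub>N\<^sup>m\<^sup>,\<^sup>k\<close> is the determinant of
  the same matrix with \<open>m - k + 1\<close> rows replaced by multiples of unit vectors, and its quotient by
  \<open>F\<^sub>N\<close> is a determinant of size \<open>m - k + 1\<close> formed by entries of the inverse Kasteleyn matrix.

  Along the diagonals the Kasteleyn matrix acts on coefficient vectors as multiplication by
  \<open>1 + a u\<close> and \<open>\<plusminus>(u - a)\<close>. So its inverse is read off the partial fraction decomposition
  \<open>(1 + a u)\<^bsup>m\<^esup> P + (u - a)\<^bsup>N-m+1\<^esup> Q = u\<^bsup>N-m+n'\<^esup>\<close>, and residue calculus identifies \<open>K\<^sub>N\<^sub>,\<^sub>m(n, n')\<close>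
  with the coefficient of \<open>u\<^bsup>N-m+n\<^esup>\<close> in \<open>(1 + a u)\<^bsup>m\<^esup> P\<close>. It vanishes for \<open>n > m\<close>, which makes the
  Fredholm determinant that of a matrix indexed by \<open>k, \<dots>, m\<close>.\<close>

section \<open>Signs of permutations and inversions\<close>

text \<open>The quotient is taken without division: explicit rows are collected in a matrix
  \<open>L\<close> with \<open>L\<close> times the full matrix equal to the cut one, and
  determinants multiply. Such a row solves a first-order recurrence between neighbouring diagonals
  with a single jump, at the column diagonal \<open>m - 1\<close>. Since a diagonal carries
  \<open>N\<close> row squares, its polynomials must have degree below \<open>N\<close>, which is
  why \<open>P\<close> has degree at most \<open>N - m\<close> and \<open>Q\<close> degree below
  \<open>m\<close>; the jump condition is the partial fraction identity.

  The offset \<open>N - m\<close> between kernel indices and exponents: the cut squares on diagonal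
  \<open>m\<close> have positions \<open>p \<ge> N - m + k - 1\<close>, so their left neighbours
  have positions \<open>q = p + 1\<close> from \<open>N - m + k\<close> to \<open>N\<close>, and
  \<open>n = q - (N - m)\<close> runs from \<open>k\<close> to \<open>m\<close>.

  The \<open>1\<close> in \<open>1 - K\<close> comes from the right-hand side of that identity:
  \<open>(u - a)^(N-m+1) Q\<close> is a monomial minus \<open>(1 + a u)^m P\<close>, and the
  monomials form the identity matrix. The recurrence supplies one factor \<open>u - a\<close> less,
  which costs only a unitriangular change of columns.\<close>

definition inversions :: "nat \<Rightarrow> (nat \<Rightarrow> nat) \<Rightarrow> (nat \<times> nat) set" where
  "inversions n p = {(i, j). i < j \<and> j < n \<and> p j < p i}"

text \<open>Written as a product over all pairs, not as a power of a count, so that multiplicativity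
  follows by reindexing.\<close>

definition inversion_sign :: "nat \<Rightarrow> (nat \<Rightarrow> nat) \<Rightarrow> int" where
  "inversion_sign n p = (\<Prod>(i, j) \<in> {(i, j). i < j \<and> j < n}. if p j < p i then -1 else 1)"

lemma inversion_sign_card: "inversion_sign n p = (-1) ^ card (inversions n p)"
proof -
  let ?S = "{(i, j). i < j \<and> j < n}"
  have fin: "finite ?S"
    by (rule finite_subset[of _ "{..<n} \<times> {..<n}"]) auto
  have "inversion_sign n p = (\<Prod>x\<in>?S. if x \<in> inversions n p then -1 else 1)"
    unfolding inversion_sign_def inversions_def by (intro prod.cong) (auto split: if_splits)
  also have "\<dots> = (\<Prod>x\<in>?S \<inter> inversions n p. -1)"
    using fin by (rule prod.inter_restrict[symmetric])
  also have "?S \<inter> inversions n p = inversions n p"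
    by (auto simp: inversions_def)
  finally show ?thesis by simp
qed

text \<open>Replacing each pair by its sorted image under \<open>q\<close> permutes the set of
  pairs, so the product for \<open>p\<close> may be taken over these images. Then the factors
  multiply pair by pair: \<open>p \<circ> q\<close> inverts a pair exactly when one but not both of
  the two steps does.\<close>

lemma inversion_sign_compose:
  assumes p: "p permutes {..<n}" and q: "q permutes {..<n}"
  shows "inversion_sign n (p \<circ> q) = inversion_sign n p * inversion_sign n q"
proof -
  let ?S = "{(i, j). i < j \<and> j < n} :: (nat \<times> nat) set"
  let ?e = "\<lambda>p (i, j). if p j < (p :: nat \<Rightarrow> nat) i then -1 else (1 :: int)"
  define h where "h = (\<lambda>(i, j). (min (q i) (q j), max (q i) (q j)))"
  have fin: "finite ?S"
    by (rule finite_subset[of _ "{..<n} \<times> {..<n}"]) auto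
  have injp: "p x = p y \<longleftrightarrow> x = y" and injq: "q x = q y \<longleftrightarrow> x = y" for x y
    using permutes_inj[OF p] permutes_inj[OF q] by (auto simp: inj_eq)
  have rq: "q x < n \<longleftrightarrow> x < n" for x
    using permutes_in_image[OF q] by simp
  have inj: "inj_on h ?S"
  proof (rule inj_onI, clarify)
    fix i j i' j' assume "i < j" "i' < j'" and e: "h (i, j) = h (i', j')"
    then have "{q i, q j} = {q i', q j'}"
      by (auto simp: h_def min_def max_def split: if_splits)
    then have "{i, j} = {i', j'}"
      by (auto simp: doubleton_eq_iff injq)
    then show "i = i' \<and> j = j'"
      using \<open>i < j\<close> \<open>i' < j'\<close> by (auto simp: doubleton_eq_iff)
  qed
  have "h ` ?S \<subseteq> ?S"
    by (auto simp: h_def rq min_def max_def injq not_le) (metis injq linorder_neqE_nat nat_less_le)+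
  then have bij: "bij_betw h ?S ?S"
    using inj fin by (simp add: bij_betw_def endo_inj_surj)
  have "inversion_sign n p = (\<Prod>x\<in>?S. ?e p (h x))"
    unfolding inversion_sign_def by (rule prod.reindex_bij_betw[OF bij, symmetric])
  then have "inversion_sign n p * inversion_sign n q = (\<Prod>x\<in>?S. ?e p (h x) * ?e q x)"
    by (simp add: inversion_sign_def prod.distrib)
  also have "\<dots> = inversion_sign n (p \<circ> q)"
    unfolding inversion_sign_def
  proof (rule prod.cong[OF refl], clarify)
    fix i j :: nat assume "i < j"
    then have "p (q i) \<noteq> p (q j)" "q i \<noteq> q j"
      by (simp_all add: injp injq)
    then show "?e p (h (i, j)) * (if q j < q i then -1 else 1)
        = (if (p \<circ> q) j < (p \<circ> q) i then -1 else 1)"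
      by (auto simp: h_def min_def max_def)
  qed
  finally show ?thesis by simp
qed

lemma inversion_sign_transpose:
  assumes "a < n" "b < n" "a \<noteq> b"
  shows "inversion_sign n (Transposition.transpose a b) = -1"
proof -
  have *: "inversion_sign n (Transposition.transpose a b) = -1" if "a < b" "b < n" for a b
  proof -
    \<comment> \<open>Inverted are the two endpoints and each endpoint with every place strictly
      between: \<open>2 * (b - a) - 1\<close> pairs.\<close>
    have "inversions n (Transposition.transpose a b) = Pair a ` {a<..b} \<union> (\<lambda>i. (i, b)) ` {a<..<b}"
      using that by (auto simp: inversions_def Transposition.transpose_def image_iff split: if_splits)
    moreover have "card (Pair a ` {a<..b} \<union> (\<lambda>i. (i, b)) ` {a<..<b}) = (b - a) + (b - a - 1)"
      by (subst card_Un_disjoint) (auto simp: card_image inj_on_def)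
    moreover have "odd ((b - a) + (b - a - 1))" using that by presburger
    ultimately show ?thesis by (simp add: inversion_sign_card)
  qed
  show ?thesis
    using *[of a b] *[of b a] assms by (cases "a < b") (auto simp: transpose_commute)
qed

text \<open>Both sides are multiplicative and equal -1 on transpositions, which generate.\<close>

lemma sign_eq_inversions:
  assumes "p permutes {..<n}"
  shows "sign p = (-1) ^ card (inversions n p)"
proof -
  have "sign p = inversion_sign n p"
    using assms finite_lessThan
  proof (induction rule: permutes_induct)
    case id
    then show ?case by (simp add: inversion_sign_def case_prod_unfold)
  next
    case (swap a b p)
    then show ?case
      by (subst sign_compose, simp add: permutation_swap_id, 
          metis finite_lessThan permutation_permutes,
          subst inversion_sign_compose)
         (auto simp: sign_swap_id inversion_sign_transpose permutes_swap_id)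
  qed
  then show ?thesis by (simp add: inversion_sign_card)
qed

text \<open>An entry \<open>j \<in> D\<close> is the second one of exactly \<open>j - p j\<close> inversions, because all values below \<open>p j\<close>
  are taken at places below \<open>j\<close>.\<close>

lemma sign_layered:
  assumes p: "p permutes {..<n}" and D: "D \<subseteq> {..<n}"
    and inv: "\<And>i j. (i, j) \<in> inversions n p \<Longrightarrow> i \<notin> D \<and> j \<in> D"
  shows "sign p = (\<Prod>j\<in>D. (-1) ^ (j + p j))"
proof -
  have finD: "finite D" using D finite_subset by blast
  have inj: "inj p" using p by (rule permutes_inj)
  have eq: "card {i. i < j \<and> p j < p i} + p j = j" if j: "j \<in> D" for j
  proof -
    have jn: "j < n" using j D by auto
    have "{i. p i < p j} \<subseteq> {..<j}"
    proof (rule subsetI)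
      fix i assume "i \<in> {i. p i < p j}"
      then have i: "p i < p j" by simp
      have pj: "p j < n" using jn permutes_in_image[OF p] by simp
      then have "i < n" using i permutes_in_image[OF p, of i] by simp
      \<comment> \<open>Otherwise \<open>(j, i)\<close> would be an inversion with \<open>j\<close>
        in first place, which membership in \<open>D\<close> excludes.\<close>
      moreover have "\<not> j < i" 
        using inv[of j i] i j \<open>i < n\<close> by (auto simp: inversions_def)
      moreover have "i \<noteq> j" using i by auto
      ultimately show "i \<in> {..<j}" by simp
    qed
    then have "{..<j} = {i. i < j \<and> p j < p i} \<union> {i. p i < p j}"
      using inj by (auto simp: inj_eq linorder_neq_iff dest: injD)
    moreover have "card {i. p i < p j} = p j"
    proof -
      have "{i. p i < p j} = inv_into UNIV p ` {..<p j}"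
      proof (intro equalityI subsetI)
        fix x assume "x \<in> {i. p i < p j}"
        then show "x \<in> inv_into UNIV p ` {..<p j}"
          using permutes_inverses(2)[OF p, of x] by (intro image_eqI[of _ _ "p x"]) auto
      qed (auto simp: permutes_inverses(1)[OF p])
      moreover have "inj_on (inv_into UNIV p) {..<p j}"
        using permutes_inj[OF permutes_inv[OF p]] by (rule inj_on_subset) simp
      ultimately show ?thesis by (simp add: card_image)
    qed
    moreover have "finite {i. p i < p j}"
      using \<open>{i. p i < p j} \<subseteq> {..<j}\<close> finite_subset by blast
    ultimately have "j = card {i. i < j \<and> p j < p i} + card {i. p i < p j}"
      using card_Un_disjoint[of "{i. i < j \<and> p j < p i}" "{i. p i < p j}"]
      by (metis (no_types, lifting) card_lessThan disjoint_iff finite_Un finite_lessThan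
          mem_Collect_eq not_less_iff_gr_or_eq)
    then show ?thesis using \<open>card {i. p i < p j} = p j\<close> by simp
  qed
  have "inversions n p = (\<Union>j\<in>D. (\<lambda>i. (i, j)) ` {i. i < j \<and> p j < p i})"
    using inv D by (auto simp: inversions_def)
  then have "card (inversions n p) = (\<Sum>j\<in>D. card ((\<lambda>i. (i, j)) ` {i. i < j \<and> p j < p i}))"
    using finD by (simp only:, subst card_UN_disjoint) (auto intro: finite_subset[of _ "{..<_}"])
  also have "\<dots> = (\<Sum>j\<in>D. card {i. i < j \<and> p j < p i})"
    by (simp add: card_image inj_on_def)
  finally have "sign p = (\<Prod>j\<in>D. (-1) ^ card {i. i < j \<and> p j < p i})"
    by (simp add: sign_eq_inversions[OF p] power_sum)
  also have "\<dots> = (\<Prod>j\<in>D. (-1) ^ (j + p j))"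
  proof (rule prod.cong[OF refl])
    fix j assume "j \<in> D"
    from eq[OF this] have *: "j + p j = card {i. i < j \<and> p j < p i} + 2 * p j" by simp
    show "(-1) ^ card {i. i < j \<and> p j < p i} = ((-1) ^ (j + p j) :: int)"
      unfolding * by (simp only: power_add power_mult) simp
  qed
  finally show ?thesis .
qed

section \<open>Domino tilings as perfect matchings of unit squares\<close>

type_synonym cell = "int \<times> int"

definition cell_square :: "cell \<Rightarrow> region" where
  "cell_square c = unit_square (fst c) (snd c)"

definition cell_region :: "cell set \<Rightarrow> region" where
  "cell_region C = (\<Union>c\<in>C. cell_square c)"

definition cell_adj :: "cell \<Rightarrow> cell \<Rightarrow> bool" where
  "cell_adj c d \<longleftrightarrow> \<bar>fst c - fst d\<bar> + \<bar>snd c - snd d\<bar> = 1"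

definition cell_domino :: "cell \<Rightarrow> cell \<Rightarrow> region" where
  "cell_domino c d = cell_square c \<union> cell_square d"

text \<open>Closed squares overlap along their edges, but a centre lies in exactly one of them; so
  centres recover the squares from a domino or a region.\<close>

definition cell_center :: "cell \<Rightarrow> real \<times> real" where
  "cell_center c = (real_of_int (fst c) + 1/2, real_of_int (snd c) + 1/2)"

lemma cell_center_in_square: "cell_center c \<in> cell_square d \<longleftrightarrow> c = d"
  by (auto simp: cell_center_def cell_square_def unit_square_def prod_eq_iff)

lemma cell_center_in_domino: "cell_center e \<in> cell_domino c d \<longleftrightarrow> e \<in> {c, d}"
  by (auto simp: cell_domino_def cell_center_in_square)

lemma cell_center_in_region: "cell_center c \<in> cell_region C \<longleftrightarrow> c \<in> C"
  by (auto simp: cell_region_def cell_center_in_square)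

lemma cell_domino_eq_iff: "cell_domino c d = cell_domino c' d' \<longleftrightarrow> {c, d} = {c', d'}"
proof
  assume "cell_domino c d = cell_domino c' d'"
  then have "e \<in> {c, d} \<longleftrightarrow> e \<in> {c', d'}" for e
    by (metis cell_center_in_domino)
  then show "{c, d} = {c', d'}" by blast
qed (auto simp: cell_domino_def doubleton_eq_iff)

lemma cell_domino_commute: "cell_domino c d = cell_domino d c"
  by (simp add: cell_domino_def Un_commute)

lemma cell_domino_vertical:
  "cell_domino (i, l) (i, l + 1)
     = {real_of_int i .. real_of_int i + 1} \<times> {real_of_int l .. real_of_int l + 2}"
  by (auto simp: cell_domino_def cell_square_def unit_square_def)

lemma cell_domino_horizontal:
  "cell_domino (i, l) (i + 1, l)
     = {real_of_int i .. real_of_int i + 2} \<times> {real_of_int l .. real_of_int l + 1}"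
  by (auto simp: cell_domino_def cell_square_def unit_square_def)

lemma vertical_domino_iff: "vertical_domino D \<longleftrightarrow> (\<exists>i l. D = cell_domino (i, l) (i, l + 1))"
  by (simp add: vertical_domino_def cell_domino_vertical)

lemma horizontal_domino_iff: "horizontal_domino D \<longleftrightarrow> (\<exists>i l. D = cell_domino (i, l) (i + 1, l))"
  by (simp add: horizontal_domino_def cell_domino_horizontal)

lemma cell_adj_cases:
  assumes "cell_adj c d"
  obtains i l where "{c, d} = {(i, l), (i, l + 1)}" | i l where "{c, d} = {(i, l), (i + 1, l)}"
proof -
  obtain i l i' l' where cd: "c = (i, l)" "d = (i', l')" by (metis surj_pair)
  with assms have "\<bar>i - i'\<bar> + \<bar>l - l'\<bar> = 1" by (simp add: cell_adj_def)
  then consider "i' = i" "l' = l + 1" | "i' = i" "l = l' + 1" | "l' = l" "i' = i + 1" | "l' = l" "i = i' + 1"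
    by linarith
  then show thesis
    by cases (use that cd in \<open>auto simp: insert_commute\<close>)
qed

lemma domino_iff:
  "vertical_domino D \<or> horizontal_domino D \<longleftrightarrow> (\<exists>c d. cell_adj c d \<and> D = cell_domino c d)"
proof
  assume "vertical_domino D \<or> horizontal_domino D"
  then show "\<exists>c d. cell_adj c d \<and> D = cell_domino c d"
    unfolding vertical_domino_iff horizontal_domino_iff
    by (elim disjE exE) (intro exI conjI; (assumption | simp add: cell_adj_def))+
next
  assume "\<exists>c d. cell_adj c d \<and> D = cell_domino c d"
  then obtain c d where cd: "cell_adj c d" "D = cell_domino c d" by blast
  from cd(1) show "vertical_domino D \<or> horizontal_domino D"
    by (cases rule: cell_adj_cases)
      (auto simp: cd(2) vertical_domino_iff horizontal_domino_iff cell_domino_eq_iff)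
qed

lemma vertical_cell_domino_iff:
  assumes "cell_adj c d"
  shows "vertical_domino (cell_domino c d) \<longleftrightarrow> fst c = fst d"
  using assms
proof (cases rule: cell_adj_cases)
  case (1 i l)
  then have "vertical_domino (cell_domino c d)"
    by (auto simp: vertical_domino_iff cell_domino_eq_iff)
  then show ?thesis using 1 by (auto simp: doubleton_eq_iff)
next
  case (2 i l)
  then have "\<not> vertical_domino (cell_domino c d)"
    by (auto simp: vertical_domino_iff cell_domino_eq_iff doubleton_eq_iff)
  then show ?thesis using 2 by (auto simp: doubleton_eq_iff)
qed

lemma closed_cell_square: "closed (cell_square c)"
  unfolding cell_square_def unit_square_def by (intro closed_Times) auto

lemma interior_cell_square_Int:
  assumes "c \<noteq> d"
  shows "interior (cell_square c \<inter> cell_square d) = {}"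
proof -
  have "interior (cell_square c) \<inter> interior (cell_square d) = {}"
    using assms unfolding cell_square_def unit_square_def interior_Times interior_atLeastAtMost_real
    by (auto simp: prod_eq_iff)
  then show ?thesis by (simp add: interior_Int)
qed

lemma cell_domino_interior_disjoint:
  "interior (cell_domino c d) \<inter> interior (cell_domino c' d') = {} \<longleftrightarrow> {c, d} \<inter> {c', d'} = {}"
proof
  assume disj: "interior (cell_domino c d) \<inter> interior (cell_domino c' d') = {}"
  have "e \<notin> {c', d'}" if "e \<in> {c, d}" for e
  proof
    assume "e \<in> {c', d'}"
    have "cell_center e \<in> interior (cell_square e)"
      unfolding cell_square_def unit_square_def interior_Times interior_atLeastAtMost_real
      by (simp add: cell_center_def)
    moreover have "interior (cell_square e) \<subseteq> interior (cell_domino c d)"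
      "interior (cell_square e) \<subseteq> interior (cell_domino c' d')"
      using \<open>e \<in> {c, d}\<close> \<open>e \<in> {c', d'}\<close> by (auto intro!: interior_mono simp: cell_domino_def)
    ultimately show False using disj by auto
  qed
  then show "{c, d} \<inter> {c', d'} = {}" by blast
next
  assume "{c, d} \<inter> {c', d'} = {}"
  then have ne: "c \<noteq> c'" "c \<noteq> d'" "d \<noteq> c'" "d \<noteq> d'" by auto
  \<comment> \<open>The interior of a domino also contains the open edge between its squares, so it
    is not the union of their interiors. The intersection of the dominoes is therefore split into
    four closed pieces with empty interior, whose union again has empty interior.\<close>
  have "cell_domino c d \<inter> cell_domino c' d' =
    (cell_square c \<inter> cell_square c') \<union> ((cell_square c \<inter> cell_square d') \<union>
    ((cell_square d \<inter> cell_square c') \<union> (cell_square d \<inter> cell_square d')))"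
    by (auto simp: cell_domino_def)
  moreover have "interior \<dots> = {}"
    using ne by (simp add: interior_closed_Un_empty_interior closed_cell_square closed_Int
        interior_cell_square_Int del: interior_Int)
  ultimately show "interior (cell_domino c d) \<inter> interior (cell_domino c' d') = {}"
    by (metis interior_Int)
qed

lemma cell_domino_subset_region: "cell_domino c d \<subseteq> cell_region C \<longleftrightarrow> {c, d} \<subseteq> C"
proof
  assume "cell_domino c d \<subseteq> cell_region C"
  then have "e \<in> C" if "e \<in> {c, d}" for e
    using that by (metis cell_center_in_domino cell_center_in_region subsetD)
  then show "{c, d} \<subseteq> C" by blast
qed (auto simp: cell_domino_def cell_region_def)

text \<open>Extensional functions, so that a matching is determined by its values on
  \<open>A\<close> and corresponds to just one tiling.\<close>

definition cell_matchings :: "cell set \<Rightarrow> cell set \<Rightarrow> (cell \<Rightarrow> cell) set" where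
  "cell_matchings A B = {f \<in> A \<rightarrow>\<^sub>E B. bij_betw f A B \<and> (\<forall>c\<in>A. cell_adj c (f c))}"

section \<open>Tilings of a two-coloured set of squares as perfect matchings\<close>

context
  fixes A B :: "cell set" and e :: int
  assumes fin: "finite A"
    and even_A: "\<And>c. c \<in> A \<Longrightarrow> even (fst c + snd c + e)"
    and odd_B: "\<And>c. c \<in> B \<Longrightarrow> odd (fst c + snd c + e)"
begin

lemma disjoint_colours: "A \<inter> B = {}"
  using even_A odd_B by blast

lemma domino_two_colours:
  assumes "cell_adj c d" "{c, d} \<subseteq> A \<union> B"
  shows "c \<in> A \<and> d \<in> B \<or> c \<in> B \<and> d \<in> A"
proof -
  have "odd (fst c + snd c + e + (fst d + snd d + e))"
    using assms(1) unfolding cell_adj_def by presburger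
  then show ?thesis using assms(2) even_A odd_B by (metis Un_iff even_add insert_subset)
qed

definition tiling_of_matching :: "(cell \<Rightarrow> cell) \<Rightarrow> region set" where
  "tiling_of_matching f = (\<lambda>c. cell_domino c (f c)) ` A"

lemma cell_domino_colour_eq:
  assumes "c \<in> A" "c' \<in> A" "d \<in> B" "d' \<in> B" "cell_domino c d = cell_domino c' d'"
  shows "c = c' \<and> d = d'"
  using assms disjoint_colours by (auto simp: cell_domino_eq_iff doubleton_eq_iff)

lemma tiling_of_matching_tiling:
  assumes "f \<in> cell_matchings A B"
  shows "tiling_of_matching f \<in> domino_tilings (cell_region (A \<union> B))"
proof -
  from assms have f: "f \<in> A \<rightarrow> B" "bij_betw f A B" and adj: "\<And>c. c \<in> A \<Longrightarrow> cell_adj c (f c)"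
    by (auto simp: cell_matchings_def)
  have "pairwise (\<lambda>D E. interior D \<inter> interior E = {}) (tiling_of_matching f)"
  proof (rule pairwiseI)
    fix D E assume "D \<in> tiling_of_matching f" "E \<in> tiling_of_matching f" "D \<noteq> E"
    then obtain c d where cd: "c \<in> A" "d \<in> A" "c \<noteq> d" "D = cell_domino c (f c)" "E = cell_domino d (f d)"
      by (auto simp: tiling_of_matching_def)
    moreover have "f c \<noteq> f d"
      using f(2) cd(1-3) by (auto simp: bij_betw_def inj_on_def)
    ultimately have "{c, f c} \<inter> {d, f d} = {}"
      using f(1) disjoint_colours by auto
    then show "interior D \<inter> interior E = {}"
      unfolding cd by (subst cell_domino_interior_disjoint)
  qed
  moreover have "D \<subseteq> cell_region (A \<union> B)" "vertical_domino D \<or> horizontal_domino D"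
    if "D \<in> tiling_of_matching f" for D
  proof -
    from that obtain c where "c \<in> A" "D = cell_domino c (f c)"
      by (auto simp only: tiling_of_matching_def)
    then show "D \<subseteq> cell_region (A \<union> B)" "vertical_domino D \<or> horizontal_domino D"
      using f(1) adj cell_domino_subset_region[of c "f c"] domino_iff by blast+
  qed
  moreover have "\<Union> (tiling_of_matching f) = cell_region (A \<union> f ` A)"
    by (auto simp: tiling_of_matching_def cell_domino_def cell_region_def)
  moreover have "f ` A = B" using f(2) by (simp add: bij_betw_def)
  ultimately show ?thesis by (auto simp: domino_tilings_def)
qed

lemma inj_on_tiling_of_matching: "inj_on tiling_of_matching (cell_matchings A B)"
proof (rule inj_onI)
  fix f g assume fg: "f \<in> cell_matchings A B" "g \<in> cell_matchings A B"
    and eq: "tiling_of_matching f = tiling_of_matching g"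
  have "f c = g c" if "c \<in> A" for c
  proof -
    have "cell_domino c (f c) \<in> tiling_of_matching g"
      using that by (simp flip: eq) (simp add: tiling_of_matching_def)
    then obtain d where "d \<in> A" "cell_domino c (f c) = cell_domino d (g d)"
      by (auto simp: tiling_of_matching_def)
    then show ?thesis
      using cell_domino_colour_eq[of c d "f c" "g d"] that fg by (auto simp: cell_matchings_def)
  qed
  then show "f = g"
    using fg by (intro extensionalityI[of f A g]) (auto simp: cell_matchings_def PiE_def)
qed

text \<open>The squares of a domino have different colours, so it joins one square of
  \<open>A\<close> to one of \<open>B\<close>. Every centre is covered, and two dominoes with a
  common square overlap in their interiors and hence coincide: every square has exactly one
  partner.\<close>

lemma tiling_is_matching:
  assumes "T \<in> domino_tilings (cell_region (A \<union> B))"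
  obtains f where "f \<in> cell_matchings A B" "T = tiling_of_matching f"
proof -
  from assms have dom: "\<And>D. D \<in> T \<Longrightarrow> (\<exists>c d. cell_adj c d \<and> D = cell_domino c d) \<and> D \<subseteq> cell_region (A \<union> B)"
    and pw: "pairwise (\<lambda>D E. interior D \<inter> interior E = {}) T"
    and un: "\<Union> T = cell_region (A \<union> B)"
    unfolding domino_tilings_def domino_iff by auto
  have two: "\<exists>c\<in>A. \<exists>d\<in>B. cell_adj c d \<and> D = cell_domino c d" if D: "D \<in> T" for D
  proof -
    obtain c d where cd: "cell_adj c d" "D = cell_domino c d" "D \<subseteq> cell_region (A \<union> B)"
      using dom[OF D] by blast
    then have "c \<in> A \<and> d \<in> B \<or> c \<in> B \<and> d \<in> A"
      using domino_two_colours[OF cd(1)] cell_domino_subset_region[of c d "A \<union> B"] by simp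
    moreover have "cell_adj d c" using cd(1) by (simp add: cell_adj_def abs_minus_commute)
    ultimately show ?thesis using cd(1,2) cell_domino_commute[of c d] by metis
  qed
  have pwD: "D = E \<or> interior D \<inter> interior E = {}" if "D \<in> T" "E \<in> T" for D E
    using pw that unfolding pairwise_def by blast
  have share: "D = E" if "D \<in> T" "E \<in> T" "D = cell_domino c d" "E = cell_domino c' d'" "{c, d} \<inter> {c', d'} \<noteq> {}"
    for D E c d c' d'
    using pwD[OF that(1,2)] that(3-5) by (auto simp only: cell_domino_interior_disjoint)
  have cover: "\<exists>D\<in>T. cell_center c \<in> D" if "c \<in> A \<union> B" for c
    using that un cell_center_in_region[of c "A \<union> B"] by blast
  have ex: "\<exists>d\<in>B. cell_adj c d \<and> cell_domino c d \<in> T" if c: "c \<in> A" for c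
  proof -
    obtain D where D: "D \<in> T" "cell_center c \<in> D" using cover c by blast
    obtain c' d' where cd: "c' \<in> A" "d' \<in> B" "cell_adj c' d'" "D = cell_domino c' d'"
      using two[OF D(1)] by blast
    have "c \<in> {c', d'}"
      using D(2) cd(4) cell_center_in_domino by simp
    then have "c = c'" using cd c disjoint_colours by blast
    then show ?thesis using cd D(1) by blast
  qed
  then obtain f0 where f0: "\<And>c. c \<in> A \<Longrightarrow> f0 c \<in> B \<and> cell_adj c (f0 c) \<and> cell_domino c (f0 c) \<in> T"
    by metis
  define f where "f = restrict f0 A"
  have f: "f c \<in> B" "cell_adj c (f c)" "cell_domino c (f c) \<in> T" if "c \<in> A" for c
    using f0[OF that] that by (auto simp: f_def)
  have fD: "f c = d" if "c \<in> A" "d \<in> B" "cell_domino c d \<in> T" for c d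
    using share[OF f(3)[OF that(1)] that(3) refl refl] cell_domino_colour_eq[of c c "f c" d] that f(1)
    by blast
  have inj: "inj_on f A"
  proof (rule inj_onI)
    fix c d assume "c \<in> A" "d \<in> A" "f c = f d"
    then have "cell_domino c (f c) = cell_domino d (f d)"
      using share[OF f(3) f(3) refl refl] by blast
    then show "c = d"
      using cell_domino_colour_eq[of c d "f c" "f d"] f(1) \<open>c \<in> A\<close> \<open>d \<in> A\<close> by blast
  qed
  moreover have "f ` A = B"
  proof
    show "B \<subseteq> f ` A"
    proof
      fix d assume d: "d \<in> B"
      obtain D where D: "D \<in> T" "cell_center d \<in> D" using cover d by blast
      obtain c' d' where cd: "c' \<in> A" "d' \<in> B" "cell_adj c' d'" "D = cell_domino c' d'"
        using two[OF D(1)] by blast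
      then have "d \<in> {c', d'}"
        using D(2) cell_center_in_domino by simp
      then have "d = d'" using cd d disjoint_colours by blast
      then show "d \<in> f ` A" using fD[of c' d'] cd D(1) by blast
    qed
  qed (use f in auto)
  ultimately have "f \<in> cell_matchings A B"
    using f by (auto simp: cell_matchings_def bij_betw_def f_def)
  moreover have "T = tiling_of_matching f"
  proof
    show "T \<subseteq> tiling_of_matching f"
    proof
      fix D assume "D \<in> T"
      with two obtain c d where "c \<in> A" "d \<in> B" "D = cell_domino c d" by blast
      with fD[of c d] \<open>D \<in> T\<close> show "D \<in> tiling_of_matching f"
        by (auto simp: tiling_of_matching_def)
    qed
  qed (use f in \<open>auto simp: tiling_of_matching_def\<close>)
  ultimately show thesis by (rule that)
qed

lemma num_vertical_tiling_of_matching: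
  assumes "f \<in> cell_matchings A B"
  shows "num_vertical (tiling_of_matching f) = card {c \<in> A. fst c = fst (f c)}"
proof -
  from assms have f: "\<And>c. c \<in> A \<Longrightarrow> f c \<in> B" and adj: "\<And>c. c \<in> A \<Longrightarrow> cell_adj c (f c)"
    by (auto simp: cell_matchings_def)
  have "{D \<in> tiling_of_matching f. vertical_domino D} = (\<lambda>c. cell_domino c (f c)) ` {c \<in> A. fst c = fst (f c)}"
    using adj by (auto simp: tiling_of_matching_def vertical_cell_domino_iff)
  moreover have "inj_on (\<lambda>c. cell_domino c (f c)) {c \<in> A. fst c = fst (f c)}"
    by (rule inj_onI) (use cell_domino_colour_eq f in blast)
  ultimately show ?thesis by (simp add: num_vertical_def card_image)
qed

lemma tiling_sum_cell_region:
  "tiling_sum (cell_region (A \<union> B)) a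
     = (\<Sum>f\<in>cell_matchings A B. \<Prod>c\<in>A. if fst c = fst (f c) then a else 1)"
proof -
  have "bij_betw tiling_of_matching (cell_matchings A B) (domino_tilings (cell_region (A \<union> B)))"
    unfolding bij_betw_def using inj_on_tiling_of_matching tiling_of_matching_tiling tiling_is_matching
    by blast
  then have "tiling_sum (cell_region (A \<union> B)) a
      = (\<Sum>f\<in>cell_matchings A B. a ^ num_vertical (tiling_of_matching f))"
    unfolding tiling_sum_def by (rule sum.reindex_bij_betw[symmetric])
  also have "\<dots> = (\<Sum>f\<in>cell_matchings A B. \<Prod>c\<in>A. if fst c = fst (f c) then a else 1)"
    by (intro sum.cong refl) (simp add: num_vertical_tiling_of_matching prod.If_cases fin Int_def)
  finally show ?thesis .
qed

end

section \<open>The two diamonds as sets of squares\<close>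

lemma squares_within_eq: "squares_within R = cell_region {c. cell_square c \<subseteq> R}"
  unfolding squares_within_def cell_region_def cell_square_def by force

lemma aztec_diamond_cells:
  "aztec_diamond N = cell_region {(i, l). - int N - 1 \<le> i + l \<and> i + l \<le> int N - 1 \<and>
     - int N \<le> l - i \<and> l - i \<le> int N}" (is "_ = cell_region ?C")
proof -
  have "cell_square (i, l) \<subseteq> {(x, y). \<bar>x\<bar> + \<bar>y\<bar> \<le> real N + 1} \<longleftrightarrow> (i, l) \<in> ?C" for i l
  proof
    let ?R = "{(x, y). \<bar>x\<bar> + \<bar>y\<bar> \<le> real N + 1}"
    assume "cell_square (i, l) \<subseteq> ?R"
    then have "(x, y) \<in> ?R" if "(x, y) \<in> cell_square (i, l)" for x y
      using that by blast
    then have *: "\<bar>x\<bar> + \<bar>y\<bar> \<le> real N + 1" if "i \<le> x" "x \<le> i + 1" "l \<le> y" "y \<le> l + 1" for x y :: real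
      using that by (auto simp: cell_square_def unit_square_def)
    \<comment> \<open>Each of the four inequalities is the condition at one corner of the
      square.\<close>
    show "(i, l) \<in> ?C"
      using *[of i l] *[of "i + 1" l] *[of i "l + 1"] *[of "i + 1" "l + 1"] by auto
  next
    assume "(i, l) \<in> ?C"
    then have "real_of_int (- int N - 1) \<le> real_of_int (i + l)" "real_of_int (i + l) \<le> real_of_int (int N - 1)"
      "real_of_int (- int N) \<le> real_of_int (l - i)" "real_of_int (l - i) \<le> real_of_int (int N)"
      unfolding of_int_le_iff by auto
    then show "cell_square (i, l) \<subseteq> {(x, y). \<bar>x\<bar> + \<bar>y\<bar> \<le> real N + 1}"
      by (auto simp: cell_square_def unit_square_def abs_if)
  qed
  then show ?thesis
    unfolding aztec_diamond_def squares_within_eq by (intro arg_cong[of _ _ cell_region]) auto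
qed

text \<open>The two boundary lines of the cut meet at a lattice point, so no square is covered
  by the two half planes jointly without lying in one of them.\<close>

lemma reduced_aztec_diamond_cells:
  "reduced_aztec_diamond N m k = cell_region ({(i, l). - int N - 1 \<le> i + l \<and> i + l \<le> int N - 1 \<and>
     - int N \<le> l - i \<and> l - i \<le> int N} \<inter>
     {(i, l). i + l \<le> 2 * int m - int N - 3 \<or> l - i \<le> int N + 2 * int k - 2 * int m - 2})"
  (is "_ = cell_region (?C \<inter> ?H)")
proof -
  define R1 R2 where "R1 = {(x, y). \<bar>x\<bar> + \<bar>y\<bar> \<le> real N + 1}"
    and "R2 = {(x, y). y \<le> max (2 * real m - 1 - real N - x) (x - 2 * real m - 1 + real N + 2 * real k)}"
  have 1: "cell_square (i, l) \<subseteq> R2 \<longleftrightarrow> (i, l) \<in> ?H" for i l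
  proof
    assume "cell_square (i, l) \<subseteq> R2"
    then have "(x, y) \<in> R2" if "(x, y) \<in> cell_square (i, l)" for x y
      using that by blast
    then have *: "y \<le> 2 * real m - 1 - real N - x \<or> y \<le> x - 2 * real m - 1 + real N + 2 * real k"
      if "i \<le> x" "x \<le> i + 1" "l \<le> y" "y \<le> l + 1" for x y :: real
      using that by (auto simp: cell_square_def unit_square_def R2_def le_max_iff_disj)
    have "real_of_int (l + 1) \<le> real_of_int (2 * int m - 1 - int N - i) \<or>
       real_of_int (l + 1) \<le> real_of_int (i - 2 * int m - 1 + int N + 2 * int k)"
      using *[of i "l + 1"] by simp
    moreover have "real_of_int (l + 1) \<le> real_of_int (2 * int m - 1 - int N - (i + 1)) \<or>
       real_of_int (l + 1) \<le> real_of_int ((i + 1) - 2 * int m - 1 + int N + 2 * int k)"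
      using *[of "i + 1" "l + 1"] by simp
    ultimately have "i + l \<le> 2 * int m - int N - 3 \<or> l - i \<le> int N + 2 * int k - 2 * int m - 2"
      unfolding of_int_le_iff by presburger
    then show "(i, l) \<in> ?H" by simp
  next
    assume "(i, l) \<in> ?H"
    then have "real_of_int (i + l) \<le> real_of_int (2 * int m - int N - 3) \<or>
        real_of_int (l - i) \<le> real_of_int (int N + 2 * int k - 2 * int m - 2)"
      unfolding of_int_le_iff by auto
    then show "cell_square (i, l) \<subseteq> R2"
      by (auto simp: cell_square_def unit_square_def R2_def le_max_iff_disj)
  qed
  have "{c. cell_square c \<subseteq> R1 \<inter> R2} = {c. cell_square c \<subseteq> R1} \<inter> ?H"
    using 1 by auto
  moreover have "cell_region {c. cell_square c \<subseteq> R1} = cell_region ?C"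
    using aztec_diamond_cells[of N] unfolding aztec_diamond_def squares_within_eq R1_def .
  then have "{c. cell_square c \<subseteq> R1} = ?C"
    by (metis (no_types, lifting) Collect_cong cell_center_in_region mem_Collect_eq set_eqI)
  moreover have "reduced_aztec_diamond N m k = squares_within (R1 \<inter> R2)"
    unfolding reduced_aztec_diamond_def R1_def R2_def by (intro arg_cong[of _ _ squares_within]) auto
  ultimately show ?thesis by (simp add: squares_within_eq)
qed

section \<open>Tiling sums as Kasteleyn determinants\<close>

text \<open>The squares \<open>S\<^sub>i\<^sub>,\<^sub>l\<close> of the Aztec diamond, coloured by the parity of \<open>i + l\<close>, are numbered along the
  diagonals \<open>i + l = const\<close>: the row index \<open>s N + p\<close> (\<open>s \<le> N\<close>, \<open>p < N\<close>) lies on \<open>i + l = 2 s - N - 1\<close>,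
  the column index \<open>b (N + 1) + q\<close> (\<open>b < N\<close>, \<open>q \<le> N\<close>) on \<open>i + l = 2 b - N\<close>.\<close>

definition row_cell :: "nat \<Rightarrow> nat \<Rightarrow> cell" where
  "row_cell N i = (int (i div N) - 1 - int (i mod N), int (i div N) - int N + int (i mod N))"

definition col_cell :: "nat \<Rightarrow> nat \<Rightarrow> cell" where
  "col_cell N j = (int (j div Suc N) - int (j mod Suc N), int (j div Suc N) - int N + int (j mod Suc N))"

definition edge :: "nat \<Rightarrow> nat \<Rightarrow> nat \<Rightarrow> bool" where
  "edge N i j \<longleftrightarrow> (j div Suc N = i div N \<or> Suc (j div Suc N) = i div N) \<and>
     (j mod Suc N = i mod N \<or> j mod Suc N = Suc (i mod N))"

text \<open>Weight \<open>a\<close> marks the vertical neighbours: the square above, which is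
  forwards with \<open>q = p + 1\<close>, and the square below, which is backwards with
  \<open>q = p\<close>. The ring is left open because tilings are counted over the reals and
  determinants are taken over the complex numbers.\<close>

definition edge_weight :: "'a :: comm_ring_1 \<Rightarrow> nat \<Rightarrow> nat \<Rightarrow> nat \<Rightarrow> 'a" where
  "edge_weight a N i j =
     (if (j div Suc N = i div N) = (j mod Suc N = Suc (i mod N)) then a else 1)"

lemma inj_row_cell: "inj (row_cell N)"
proof (rule injI)
  fix i j assume "row_cell N i = row_cell N j"
  then have "i div N = j div N" "i mod N = j mod N"
    by (auto simp: row_cell_def)
  then show "i = j" by (metis div_mult_mod_eq)
qed

lemma inj_col_cell: "inj (col_cell N)"
proof (rule injI)
  fix i j assume "col_cell N i = col_cell N j"
  then have "i div Suc N = j div Suc N" "i mod Suc N = j mod Suc N"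
    by (auto simp: col_cell_def)
  then show "i = j" by (metis div_mult_mod_eq)
qed

lemma cell_adj_iff_edge: "cell_adj (row_cell N i) (col_cell N j) \<longleftrightarrow> edge N i j"
proof -
  \<comment> \<open>With \<open>x = s - b\<close> and \<open>y = q - p\<close> the lattice is turned
    by 45 degrees, and the four neighbours become the four choices of \<open>x\<close> and
    \<open>y\<close> in \<open>{0, 1}\<close>.\<close>
  have *: "\<bar>x + y - 1\<bar> + \<bar>x - y\<bar> = 1 \<longleftrightarrow> (x = 0 \<or> x = 1) \<and> (y = 0 \<or> y = 1)" for x y :: int
    by presburger
  have "\<bar>int s - 1 - int p - (int b - int q)\<bar> + \<bar>int s - int N + int p - (int b - int N + int q)\<bar> = 1
    \<longleftrightarrow> (b = s \<or> Suc b = s) \<and> (q = p \<or> q = Suc p)" for s p b q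
    using *[of "int s - int b" "int q - int p"] by (auto simp: algebra_simps)
  then show ?thesis
    unfolding cell_adj_def row_cell_def col_cell_def edge_def fst_conv snd_conv .
qed

lemma edge_vertical:
  assumes "edge N i j"
  shows "fst (row_cell N i) = fst (col_cell N j) \<longleftrightarrow>
    (j div Suc N = i div N) = (j mod Suc N = Suc (i mod N))"
  using assms unfolding row_cell_def col_cell_def edge_def by auto

section \<open>Matchings as permutations of the indices\<close>

definition layered_perms :: "nat \<Rightarrow> (nat \<Rightarrow> nat \<Rightarrow> bool) \<Rightarrow> (nat \<Rightarrow> nat) set" where
  "layered_perms N E = {\<pi>. \<pi> permutes {..<N * Suc N} \<and> (\<forall>i<N * Suc N. E i (\<pi> i))}"

text \<open>The signs are those of \<open>sign_layered\<close>, with the rows matched to the preceding diagonal as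
  the set \<open>D\<close>; so every tiling enters the determinant with sign \<open>+\<close>.\<close>

definition kasteleyn :: "'a :: comm_ring_1 \<Rightarrow> nat \<Rightarrow> (nat \<Rightarrow> nat \<Rightarrow> bool) \<Rightarrow> nat \<Rightarrow> nat \<Rightarrow> 'a" where
  "kasteleyn a N E i j = (if E i j then
     (if j div Suc N = i div N then 1 else (-1) ^ (i + j)) * edge_weight a N i j else 0)"

lemma mod_less_of_div_eq: "i < j \<Longrightarrow> i div N = j div N \<Longrightarrow> i mod N < j mod (N :: nat)"
  by (metis div_mult_mod_eq nat_add_left_cancel_less)

text \<open>If \<open>i\<close> were matched backwards, monotonicity of the diagonals would put
  \<open>i\<close> and \<open>j\<close> on one row diagonal and their images on one column diagonal.
  There a position changes by 0 or 1 upwards, which cannot reverse the order of two distinct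
  positions. If \<open>j\<close> were matched forwards, the same coincidence would arise.\<close>

lemma layered_inversions:
  assumes edge: "\<And>i. i < n \<Longrightarrow> edge N i (\<pi> i)" and inv: "(i, j) \<in> inversions n \<pi>"
  shows "\<pi> i div Suc N = i div N" "\<pi> j div Suc N \<noteq> j div N"
proof -
  from inv have ij: "i < j" "j < n" "\<pi> j < \<pi> i" by (auto simp: inversions_def)
  then have ei: "edge N i (\<pi> i)" and ej: "edge N j (\<pi> j)" using edge by auto
  have le: "i div N \<le> j div N" "\<pi> j div Suc N \<le> \<pi> i div Suc N"
    using ij by (auto intro: div_le_mono)
  have *: False if "i div N = j div N" "\<pi> i div Suc N = \<pi> j div Suc N"
  proof -
    have "i mod N < j mod N" "\<pi> j mod Suc N < \<pi> i mod Suc N"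
      using ij that by (auto intro: mod_less_of_div_eq)
    then show False using ei ej unfolding edge_def by (elim conjE disjE) linarith+
  qed
  show "\<pi> i div Suc N = i div N"
  proof (rule ccontr)
    assume "\<pi> i div Suc N \<noteq> i div N"
    then have "Suc (\<pi> i div Suc N) = i div N" "j div N \<le> Suc (\<pi> j div Suc N)"
      using ei ej unfolding edge_def by auto
    then show False using le * by linarith
  qed
  show "\<pi> j div Suc N \<noteq> j div N"
  proof
    assume "\<pi> j div Suc N = j div N"
    moreover have "\<pi> i div Suc N \<le> i div N" using ei unfolding edge_def by auto
    ultimately show False using le * by linarith
  qed
qed

lemma det_kasteleyn:
  assumes E: "\<And>i j. E i j \<Longrightarrow> edge N i j"
  shows "det (mat (N * Suc N) (N * Suc N) (\<lambda>(i, j). kasteleyn a N E i j))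
    = (\<Sum>\<pi>\<in>layered_perms N E. \<Prod>i<N * Suc N. edge_weight a N i (\<pi> i))"
proof -
  let ?n = "N * Suc N"
  let ?P = "{\<pi>. \<pi> permutes {..<?n}}"
  let ?k = "kasteleyn a N E"
  have fin: "finite ?P" by (simp add: finite_permutations)
  have "det (mat ?n ?n (\<lambda>(i, j). ?k i j)) = (\<Sum>\<pi>\<in>?P. of_int (sign \<pi>) * (\<Prod>i<?n. ?k i (\<pi> i)))"
  proof (subst det_def'[of _ ?n], simp, unfold atLeast0LessThan, rule sum.cong[OF refl])
    fix \<pi> assume "\<pi> \<in> ?P"
    then have "\<pi> i < ?n" if "i < ?n" for i
      using that permutes_in_image[of \<pi> "{..<?n}" i] by simp
    then show "of_int (sign \<pi>) * (\<Prod>i<?n. mat ?n ?n (\<lambda>(i, j). ?k i j) $$ (i, \<pi> i))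
        = of_int (sign \<pi>) * (\<Prod>i<?n. ?k i (\<pi> i))"
      by (intro arg_cong2[of _ _ _ _ "(*)"] refl prod.cong) auto
  qed
  also have "\<dots> = (\<Sum>\<pi>\<in>layered_perms N E. of_int (sign \<pi>) * (\<Prod>i<?n. ?k i (\<pi> i)))"
  proof (rule sum.mono_neutral_right[OF fin])
    show "\<forall>\<pi>\<in>?P - layered_perms N E. of_int (sign \<pi>) * (\<Prod>i<?n. ?k i (\<pi> i)) = 0"
    proof
      fix \<pi> assume "\<pi> \<in> ?P - layered_perms N E"
      then obtain i where "i < ?n" "\<not> E i (\<pi> i)" by (auto simp: layered_perms_def)
      then have "(\<Prod>i<?n. ?k i (\<pi> i)) = 0"
        by (intro prod_zero) (auto simp: kasteleyn_def)
      then show "of_int (sign \<pi>) * (\<Prod>i<?n. ?k i (\<pi> i)) = 0" by simp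
    qed
  qed (auto simp: layered_perms_def)
  also have "\<dots> = (\<Sum>\<pi>\<in>layered_perms N E. \<Prod>i<?n. edge_weight a N i (\<pi> i))"
  proof (rule sum.cong[OF refl])
    fix \<pi> assume "\<pi> \<in> layered_perms N E"
    then have p: "\<pi> permutes {..<?n}" and e: "\<And>i. i < ?n \<Longrightarrow> E i (\<pi> i)"
      by (auto simp: layered_perms_def)
    define D where "D = {i. i < ?n \<and> \<pi> i div Suc N \<noteq> i div N}"
    have finD: "finite D" by (simp add: D_def)
    have sgn: "sign \<pi> = (\<Prod>i\<in>D. (-1) ^ (i + \<pi> i))"
    proof (rule sign_layered[OF p])
      fix i j assume "(i, j) \<in> inversions ?n \<pi>"
      then show "i \<notin> D \<and> j \<in> D"
        using layered_inversions[of ?n N \<pi> i j] E e by (auto simp: D_def inversions_def)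
    qed (auto simp: D_def)
    have "(\<Prod>i<?n. ?k i (\<pi> i)) = (\<Prod>i<?n. (if i \<in> D then (-1) ^ (i + \<pi> i) else 1) * edge_weight a N i (\<pi> i))"
      by (intro prod.cong refl) (auto simp: kasteleyn_def e D_def)
    also have "\<dots> = (\<Prod>i<?n. if i \<in> D then (-1) ^ (i + \<pi> i) else 1) * (\<Prod>i<?n. edge_weight a N i (\<pi> i))"
      by (simp add: prod.distrib)
    also have "(\<Prod>i<?n. if i \<in> D then (-1) ^ (i + \<pi> i) else 1) = (of_int (sign \<pi>) :: 'a)"
      unfolding sgn of_int_prod
      by (subst prod.inter_restrict[symmetric]) (auto intro!: prod.cong simp: D_def)
    finally have eq: "(\<Prod>i<?n. ?k i (\<pi> i)) = of_int (sign \<pi>) * (\<Prod>i<?n. edge_weight a N i (\<pi> i))" .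
    show "of_int (sign \<pi>) * (\<Prod>i<?n. ?k i (\<pi> i)) = (\<Prod>i<?n. edge_weight a N i (\<pi> i))"
      unfolding eq mult.assoc[symmetric] of_int_mult[symmetric] sign_idempotent by simp
  qed
  finally show ?thesis .
qed

text \<open>Squares are removed together with their partners, yet the permutations keep full size:
  putting the removed dominoes back is a bijection, and being horizontal they weigh 1. So the cut
  diamond gets a matrix of the same size as the full one.\<close>

lemma sum_matchings_eq_sum_layered_perms:
  assumes R: "R \<subseteq> {..<N * Suc N}" and phi: "inj_on \<phi> R" "\<phi> ` R \<subseteq> {..<N * Suc N}"
    and horizontal: "\<And>i. i \<in> R \<Longrightarrow> edge N i (\<phi> i) \<and> edge_weight a N i (\<phi> i) = 1"
  shows "(\<Sum>f\<in>cell_matchings (row_cell N ` ({..<N * Suc N} - R)) (col_cell N ` ({..<N * Suc N} - \<phi> ` R)).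
            \<Prod>c\<in>row_cell N ` ({..<N * Suc N} - R). if fst c = fst (f c) then a else 1)
       = (\<Sum>\<pi>\<in>layered_perms N (\<lambda>i j. edge N i j \<and> (i \<in> R \<longrightarrow> j = \<phi> i)).
            \<Prod>i<N * Suc N. edge_weight a N i (\<pi> i))"
proof -
  let ?n = "N * Suc N"
  let ?I = "{..<?n} - R" and ?J = "{..<?n} - \<phi> ` R"
  let ?A = "row_cell N ` ?I" and ?B = "col_cell N ` ?J"
  let ?P = "layered_perms N (\<lambda>i j. edge N i j \<and> (i \<in> R \<longrightarrow> j = \<phi> i))"
  define ri ci where "ri = inv_into UNIV (row_cell N)" and "ci = inv_into UNIV (col_cell N)"
  have ri [simp]: "ri (row_cell N i) = i" and ci [simp]: "ci (col_cell N i) = i" for i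
    using inj_row_cell inj_col_cell by (auto simp: ri_def ci_def)
  define F where "F = (\<lambda>\<pi> :: nat \<Rightarrow> nat. restrict (\<lambda>c. col_cell N (\<pi> (ri c))) ?A)"
  \<comment> \<open>The removed dominoes are put back by \<open>\<phi>\<close>, and indices beyond
    the diamond are fixed, as \<open>permutes\<close> demands.\<close>
  define G where "G = (\<lambda>f i. if i \<in> R then \<phi> i else if i < ?n then ci (f (row_cell N i)) else i)"
  have P: "\<pi> permutes {..<?n}" "\<And>i. i \<in> ?I \<Longrightarrow> edge N i (\<pi> i)" "\<And>i. i \<in> R \<Longrightarrow> \<pi> i = \<phi> i"
    if "\<pi> \<in> ?P" for \<pi>
    using that R unfolding layered_perms_def by blast+
  have P_bij: "bij_betw \<pi> ?I ?J" if \<pi>: "\<pi> \<in> ?P" for \<pi>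
  proof -
    note p = P(1)[OF \<pi>]
    have "\<pi> ` R = \<phi> ` R" using P(3)[OF \<pi>] by (rule image_cong[OF refl])
    moreover have "\<pi> ` ?I = \<pi> ` {..<?n} - \<pi> ` R"
      using permutes_inj[OF p] by (rule image_set_diff)
    ultimately have "\<pi> ` ?I = ?J" using permutes_image[OF p] by simp
    moreover have "inj_on \<pi> ?I" using permutes_inj[OF p] by (rule inj_on_subset) simp
    ultimately show ?thesis by (simp add: bij_betw_def)
  qed
  have G: "G f \<in> ?P" "\<And>i. i \<in> ?I \<Longrightarrow> col_cell N (G f i) = f (row_cell N i)"
    if "f \<in> cell_matchings ?A ?B" for f
  proof -
    from that have bij: "bij_betw f ?A ?B" and adj: "\<And>c. c \<in> ?A \<Longrightarrow> cell_adj c (f c)"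
      by (auto simp: cell_matchings_def)
    show col: "col_cell N (G f i) = f (row_cell N i)" if i: "i \<in> ?I" for i
    proof -
      have "f (row_cell N i) \<in> ?B" using bij i by (auto simp: bij_betw_def)
      then obtain j where "f (row_cell N i) = col_cell N j" by blast
      then show ?thesis using i by (simp add: G_def)
    qed
    have "bij_betw (\<lambda>i. ci (f (row_cell N i))) ?I ?J"
    proof -
      have "bij_betw (row_cell N) ?I ?A"
        by (rule inj_on_imp_bij_betw[OF inj_on_subset[OF inj_row_cell subset_UNIV]])
      then have "bij_betw (f \<circ> row_cell N) ?I ?B" using bij by (rule bij_betw_trans)
      moreover have "bij_betw ci ?B ?J" by (rule bij_betw_byWitness[where f' = "col_cell N"]) auto
      ultimately have "bij_betw (ci \<circ> (f \<circ> row_cell N)) ?I ?J"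
        by (rule bij_betw_trans)
      then show ?thesis by (simp add: o_def)
    qed
    then have "bij_betw (G f) ?I ?J"
      by (rule bij_betw_cong[THEN iffD1, rotated]) (auto simp: G_def)
    moreover have "bij_betw (G f) R (\<phi> ` R)"
      using phi(1) by (auto simp: bij_betw_def G_def inj_on_def)
    ultimately have "bij_betw (G f) (?I \<union> R) (?J \<union> \<phi> ` R)"
      by (rule bij_betw_combine) auto
    moreover have "?I \<union> R = {..<?n}" "?J \<union> \<phi> ` R = {..<?n}" using R phi(2) by auto
    ultimately have "G f permutes {..<?n}"
      using R by (intro bij_imp_permutes) (auto simp: G_def)
    moreover have "edge N i (G f i)" if "i < ?n" for i
    proof (cases "i \<in> R")
      case True
      then show ?thesis using horizontal by (simp add: G_def)
    next
      case False
      then have "cell_adj (row_cell N i) (col_cell N (G f i))"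
        using adj[of "row_cell N i"] col[of i] that by auto
      then show ?thesis by (simp add: cell_adj_iff_edge)
    qed
    ultimately show "G f \<in> ?P" by (auto simp: layered_perms_def) (simp add: G_def)
  qed
  have "bij_betw F ?P (cell_matchings ?A ?B)"
  proof (rule bij_betw_byWitness[where f' = G])
    show "\<forall>\<pi>\<in>?P. G (F \<pi>) = \<pi>"
    proof
      fix \<pi> assume \<pi>: "\<pi> \<in> ?P"
      have "G (F \<pi>) i = \<pi> i" for i
        using P(1,3)[OF \<pi>] permutes_not_in[OF P(1)[OF \<pi>], of i]
        by (auto simp: G_def F_def)
      then show "G (F \<pi>) = \<pi>" by blast
    qed
    show "\<forall>f\<in>cell_matchings ?A ?B. F (G f) = f"
    proof
      fix f assume f: "f \<in> cell_matchings ?A ?B"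
      show "F (G f) = f"
      proof (rule extensionalityI)
        show "f \<in> extensional ?A" using f by (auto simp: cell_matchings_def PiE_def)
        fix c assume "c \<in> ?A"
        then obtain i where "i \<in> ?I" "c = row_cell N i" by blast
        then show "F (G f) c = f c" using G(2)[OF f, of i] by (auto simp: F_def)
      qed (simp add: F_def)
    qed
    show "F ` ?P \<subseteq> cell_matchings ?A ?B"
    proof
      fix f assume "f \<in> F ` ?P"
      then obtain \<pi> where \<pi>: "\<pi> \<in> ?P" "f = F \<pi>" by blast
      have "bij_betw ri ?A ?I" by (rule bij_betw_byWitness[where f' = "row_cell N"]) auto
      then have "bij_betw (\<pi> \<circ> ri) ?A ?J" using P_bij[OF \<pi>(1)] by (rule bij_betw_trans)
      moreover have "bij_betw (col_cell N) ?J ?B"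
        by (rule inj_on_imp_bij_betw[OF inj_on_subset[OF inj_col_cell subset_UNIV]])
      ultimately have "bij_betw (col_cell N \<circ> (\<pi> \<circ> ri)) ?A ?B"
        by (rule bij_betw_trans)
      then have bij: "bij_betw f ?A ?B"
        by (rule bij_betw_cong[THEN iffD1, rotated]) (auto simp: \<pi>(2) F_def)
      moreover have "f \<in> extensional ?A" by (simp add: \<pi>(2) F_def)
      moreover have "cell_adj c (f c)" if "c \<in> ?A" for c
        using that P(2)[OF \<pi>(1)] by (auto simp: \<pi>(2) F_def cell_adj_iff_edge)
      ultimately show "f \<in> cell_matchings ?A ?B"
        by (auto simp: cell_matchings_def PiE_def bij_betw_def)
    qed
    show "G ` cell_matchings ?A ?B \<subseteq> ?P" using G(1) by blast
  qed
  then have "(\<Sum>f\<in>cell_matchings ?A ?B. \<Prod>c\<in>?A. if fst c = fst (f c) then a else 1)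
    = (\<Sum>\<pi>\<in>?P. \<Prod>c\<in>?A. if fst c = fst (F \<pi> c) then a else 1)"
    by (rule sum.reindex_bij_betw[symmetric])
  also have "\<dots> = (\<Sum>\<pi>\<in>?P. \<Prod>i<?n. edge_weight a N i (\<pi> i))"
  proof (rule sum.cong[OF refl])
    fix \<pi> assume \<pi>: "\<pi> \<in> ?P"
    have "(\<Prod>c\<in>?A. if fst c = fst (F \<pi> c) then a else 1)
        = (\<Prod>i\<in>?I. if fst (row_cell N i) = fst (F \<pi> (row_cell N i)) then a else 1)"
      by (subst prod.reindex) (auto intro: inj_on_subset[OF inj_row_cell])
    also have "\<dots> = (\<Prod>i\<in>?I. edge_weight a N i (\<pi> i))"
      using P(2)[OF \<pi>] by (intro prod.cong refl) (auto simp: F_def edge_weight_def edge_vertical)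
    also have "\<dots> = (\<Prod>i<?n. edge_weight a N i (\<pi> i))"
      using horizontal P(3)[OF \<pi>] by (intro prod.mono_neutral_left) auto
    finally show "(\<Prod>c\<in>?A. if fst c = fst (F \<pi> c) then a else 1) = (\<Prod>i<?n. edge_weight a N i (\<pi> i))" .
  qed
  finally show ?thesis .
qed

text \<open>\<open>cut_rows\<close> are the row squares outside the reduced diamond, \<open>cut_col\<close> their left neighbours.\<close>

definition cut_col :: "nat \<Rightarrow> nat \<Rightarrow> nat" where
  "cut_col N i = (i div N - 1) * Suc N + Suc (i mod N)"

definition cut_rows :: "nat \<Rightarrow> nat \<Rightarrow> nat \<Rightarrow> nat set" where
  "cut_rows N m k = {i. i < N * Suc N \<and> m \<le> i div N \<and> N + k \<le> i mod N + m + 1}"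

lemma index_div_mod:
  assumes "q < (M :: nat)"
  shows "(b * M + q) div M = b" "(b * M + q) mod M = q"
  using assms by simp_all

lemma cut_col_div_mod:
  assumes "0 < N"
  shows "cut_col N i div Suc N = i div N - 1" "cut_col N i mod Suc N = Suc (i mod N)"
proof -
  have "Suc (i mod N) < Suc N" using assms by simp
  then show "cut_col N i div Suc N = i div N - 1" "cut_col N i mod Suc N = Suc (i mod N)"
    unfolding cut_col_def by (rule index_div_mod)+
qed

lemma row_div_le: "i < N * Suc N \<Longrightarrow> i div N \<le> N"
  using less_mult_imp_div_less[of i "Suc N" N] by (simp add: mult.commute)

lemma col_div_less: "j < N * Suc N \<Longrightarrow> j div Suc N < N"
  by (rule less_mult_imp_div_less)

lemma row_index: "s \<le> N \<Longrightarrow> p < N \<Longrightarrow> s * N + p < N * Suc (N :: nat)"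
  unfolding mult_Suc_right using mult_le_mono1[of s N N] by linarith

lemma col_index: "b < N \<Longrightarrow> q \<le> N \<Longrightarrow> b * Suc N + q < N * Suc (N :: nat)"
  using mult_le_mono1[of "Suc b" N "Suc N"] unfolding mult_Suc by linarith

lemma cut_col_less:
  assumes "i < N * Suc N" "1 \<le> i div N"
  shows "cut_col N i < N * Suc N"
proof -
  have "0 < N" using assms(1) by (cases N) auto
  then show ?thesis
    unfolding cut_col_def using assms row_div_le[of i N] by (intro col_index) (auto simp: Suc_le_eq)
qed

lemma cut_col_edge:
  assumes "0 < N" "1 \<le> i div N"
  shows "edge N i (cut_col N i)" "edge_weight a N i (cut_col N i) = 1"
  using assms by (auto simp: edge_def edge_weight_def cut_col_div_mod)

lemma inj_on_cut_col:
  assumes "1 \<le> m"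
  shows "inj_on (cut_col N) (cut_rows N m k)"
proof (rule inj_onI)
  fix i j assume *: "i \<in> cut_rows N m k" "j \<in> cut_rows N m k" and eq: "cut_col N i = cut_col N j"
  have N: "0 < N" using * by (cases N) (auto simp: cut_rows_def)
  have "i div N - 1 = j div N - 1" "Suc (i mod N) = Suc (j mod N)"
    using eq cut_col_div_mod[OF N] by metis+
  then have "i div N = j div N" "i mod N = j mod N"
    using * assms by (auto simp: cut_rows_def)
  then show "i = j" by (metis div_mult_mod_eq)
qed

text \<open>Induction along the removed rectangle: once the squares of one
  diagonal are matched backwards, the topmost square of the next one has a single neighbour left.\<close>

lemma cut_rows_forced:
  assumes \<pi>: "\<pi> \<in> layered_perms N (edge N)" and m: "1 \<le> m"
    and start: "\<And>i. i \<in> cut_rows N m k \<Longrightarrow> i div N = m \<Longrightarrow> \<pi> i = cut_col N i"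
    and i: "i \<in> cut_rows N m k"
  shows "\<pi> i = cut_col N i"
proof -
  let ?n = "N * Suc N"
  from \<pi> have perm: "\<pi> permutes {..<?n}" and edge: "\<And>i. i < ?n \<Longrightarrow> edge N i (\<pi> i)"
    by (auto simp: layered_perms_def)
  have N: "0 < N" using i by (cases N) (auto simp: cut_rows_def)
  have col: "s * N + p \<in> cut_rows N m k \<longleftrightarrow> m \<le> s \<and> N + k \<le> p + m + 1" if "s \<le> N" "p < N" for s p
    using that row_index[OF that] by (auto simp: cut_rows_def)
  have cut: "cut_col N (s * N + p) = (s - 1) * Suc N + Suc p" if "p < N" for s p
    using that by (simp add: cut_col_def)
  have claim: "\<forall>p<N. N + k \<le> p + m + 1 \<longrightarrow> \<pi> (s * N + p) = (s - 1) * Suc N + Suc p" if "m \<le> s" "s \<le> N" for s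
    using that
  proof (induction s rule: dec_induct)
    case base
    then show ?case using start col cut by auto
  next
    case (step s)
    then have s: "s < N" and IH: "\<And>p. p < N \<Longrightarrow> N + k \<le> p + m + 1 \<Longrightarrow> \<pi> (s * N + p) = (s - 1) * Suc N + Suc p"
      by auto
    have "N + k \<le> N - Suc d + m + 1 \<longrightarrow> \<pi> (Suc s * N + (N - Suc d)) = s * Suc N + Suc (N - Suc d)"
      if "d < N" for d
      using that
    \<comment> \<open>\<open>d\<close> counts positions downwards from the top of the diagonal.
      Instead of following the row at position \<open>N - Suc d\<close>, the proof asks which row
      covers its left neighbour, the column at position \<open>q = N - d\<close> on diagonal
      \<open>s\<close>.\<close>
    proof (induction d rule: less_induct)
      case (less d)
      show ?case
      proof
        assume k: "N + k \<le> N - Suc d + m + 1"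
        define q where "q = N - d"
        have q: "Suc (N - Suc d) = q" "q \<le> N" "1 \<le> q" using less.prems by (auto simp: q_def)
        let ?j = "s * Suc N + q"
        have "?j < ?n" using s q by (intro col_index)
        then obtain i where i: "i < ?n" "\<pi> i = ?j"
          using permutes_image[OF perm] by (metis (no_types, lifting) imageE lessThan_iff)
        have jdm: "?j div Suc N = s" "?j mod Suc N = q"
          using index_div_mod[of q "Suc N" s] q by simp_all
        have e: "s = i div N \<or> Suc s = i div N" "q = i mod N \<or> q = Suc (i mod N)"
          using edge[OF i(1)] unfolding i(2) edge_def jdm by auto
        have ieq: "i = i div N * N + i mod N" by simp
        have imod: "i mod N < N" using N by simp
        have "i div N \<noteq> s"
        \<comment> \<open>The candidates on diagonal \<open>s\<close> have position \<open>q\<close>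
          or \<open>q - 1\<close>, both inside the cut, and by \<open>IH\<close> they are matched to
          diagonal \<open>s - 1\<close>. As \<open>s \<ge> m \<ge> 1\<close>, the truncated
          difference is different from \<open>s\<close>.\<close>
        proof
          assume *: "i div N = s"
          have "\<pi> i = (s - 1) * Suc N + Suc (i mod N)"
            using IH[of "i mod N"] imod ieq e(2) k q unfolding * by auto
          then have "\<pi> i div Suc N = s - 1"
            using imod index_div_mod(1)[of "Suc (i mod N)" "Suc N" "s - 1"] by simp
          then show False using i(2) jdm(1) m step.hyps by simp
        qed
        then have idiv: "i div N = Suc s" using e(1) by auto
        \<comment> \<open>The row at position \<open>q\<close> on the next diagonal was settled by
          the inner induction hypothesis; for \<open>d = 0\<close> it does not exist, since then
          \<open>q = N\<close>.\<close>
        have "q \<noteq> i mod N"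
        proof
          assume *: "q = i mod N"
          have "q < N" using imod unfolding * .
          then have "1 \<le> d" unfolding q_def by linarith
          then have "d - 1 < d" "N - Suc (d - 1) = q" by (auto simp: q_def)
          then have "\<pi> (Suc s * N + q) = s * Suc N + Suc q"
            using less.IH[of "d - 1"] less.prems k q \<open>q < N\<close> by auto
          then have "\<pi> i = s * Suc N + Suc q" using ieq unfolding idiv * by metis
          then show False using i(2) by simp
        qed
        then have "i mod N = N - Suc d" using e(2) q by auto
        then have "i = Suc s * N + (N - Suc d)" using ieq idiv by metis
        then show "\<pi> (Suc s * N + (N - Suc d)) = s * Suc N + Suc (N - Suc d)"
          using i(2) q(1) by simp
      qed
    qed
    then have *: "N + k \<le> N - Suc d + m + 1 \<Longrightarrow> d < N \<Longrightarrow>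
        \<pi> (Suc s * N + (N - Suc d)) = s * Suc N + Suc (N - Suc d)" for d by blast
    show ?case
    proof (intro allI impI)
      fix p assume p: "p < N" "N + k \<le> p + m + 1"
      then have "N - Suc (N - Suc p) = p" "N - Suc p < N" by auto
      then show "\<pi> (Suc s * N + p) = (Suc s - 1) * Suc N + Suc p"
        using *[of "N - Suc p"] p by simp
    qed
  qed
  have "i div N * N + i mod N = i" "i mod N < N" "i div N \<le> N"
    using N i row_div_le[of i N] by (auto simp: cut_rows_def)
  then show ?thesis
    using claim[of "i div N"] i cut[of "i mod N" "i div N"] by (auto simp: cut_rows_def)
qed

section \<open>Both tiling sums as determinants of full size\<close>

lemma aztec_cells:
  "{(i, l). - int N - 1 \<le> i + l \<and> i + l \<le> int N - 1 \<and> - int N \<le> l - i \<and> l - i \<le> int N}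
    = row_cell N ` {..<N * Suc N} \<union> col_cell N ` {..<N * Suc N}" (is "?C = ?A \<union> ?B")
proof
  show "?A \<union> ?B \<subseteq> ?C"
  proof
    fix c assume "c \<in> ?A \<union> ?B"
    then consider i where "i < N * Suc N" "c = row_cell N i" | j where "j < N * Suc N" "c = col_cell N j"
      by blast
    then show "c \<in> ?C"
    proof cases
      case 1
      then have "0 < N" by (cases N) auto
      then have "i mod N < N" by simp
      then show ?thesis using 1 row_div_le[OF 1(1)] by (auto simp: row_cell_def)
    next
      case 2
      then have "j mod Suc N < Suc N" by simp
      then show ?thesis using 2 col_div_less[OF 2(1)] by (auto simp: col_cell_def)
    qed
  qed
  show "?C \<subseteq> ?A \<union> ?B"
  proof clarify
    have half: "2 * int (nat (x div 2)) = x" if "even x" "0 \<le> x" for x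
      using that by simp
    fix i l assume *: "- int N - 1 \<le> i + l" "i + l \<le> int N - 1" "- int N \<le> l - i" "l - i \<le> int N"
      and notB: "(i, l) \<notin> ?B"
    show "(i, l) \<in> ?A"
    proof (cases "even (i + l + int N + 1)")
      case True
      define s p where "s = nat ((i + l + int N + 1) div 2)" and "p = nat ((l - i + int N - 1) div 2)"
      have "even (l - i + int N - 1)" using True by presburger
      then have sp: "2 * int s = i + l + int N + 1" "2 * int p = l - i + int N - 1"
        unfolding s_def p_def using True * by (intro half; presburger)+
      then have "s \<le> N" "p < N" using * by auto
      then have "row_cell N (s * N + p) = (i, l)" "s * N + p < N * Suc N"
        using sp row_index by (auto simp: row_cell_def)
      then show ?thesis by force
    next
      case False
      define b q where "b = nat ((i + l + int N) div 2)" and "q = nat ((l - i + int N) div 2)"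
      have "even (l - i + int N)" "even (i + l + int N)" using False by presburger+
      then have bq: "2 * int b = i + l + int N" "2 * int q = l - i + int N"
        unfolding b_def q_def using * by (intro half; presburger)+
      then have "b < N" "q \<le> N" using * by auto
      then have "col_cell N (b * Suc N + q) = (i, l)" "b * Suc N + q < N * Suc N"
        using bq col_index index_div_mod[of q "Suc N" b] by (auto simp: col_cell_def simp del: mult_Suc_right)
      then show ?thesis using notB by force
    qed
  qed
qed

lemma aztec_row_parity: "even (fst (row_cell N i) + snd (row_cell N i) + (int N + 1))"
  by (simp add: row_cell_def)

lemma aztec_col_parity: "odd (fst (col_cell N i) + snd (col_cell N i) + (int N + 1))"
  by (simp add: col_cell_def)

text \<open>\<open>E\<close> may prescribe fewer edges than \<open>\<phi>\<close> as long as the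
  permutations stay the same: edges that are forced anyway need not be written into the
  matrix.\<close>

lemma tiling_sum_eq_det:
  fixes a :: real
  assumes R: "R \<subseteq> {..<N * Suc N}" and phi: "inj_on \<phi> R" "\<phi> ` R \<subseteq> {..<N * Suc N}"
    and horizontal: "\<And>i. i \<in> R \<Longrightarrow> edge N i (\<phi> i) \<and> edge_weight a N i (\<phi> i) = 1"
    and E: "layered_perms N (\<lambda>i j. edge N i j \<and> (i \<in> R \<longrightarrow> j = \<phi> i)) = layered_perms N E"
      "\<And>i j. E i j \<Longrightarrow> edge N i j"
  shows "complex_of_real (tiling_sum (cell_region
      (row_cell N ` ({..<N * Suc N} - R) \<union> col_cell N ` ({..<N * Suc N} - \<phi> ` R))) a)
    = det (mat (N * Suc N) (N * Suc N) (\<lambda>(i, j). kasteleyn (complex_of_real a) N E i j))"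
proof -
  let ?A = "row_cell N ` ({..<N * Suc N} - R)" and ?B = "col_cell N ` ({..<N * Suc N} - \<phi> ` R)"
  have "tiling_sum (cell_region (?A \<union> ?B)) a
      = (\<Sum>f\<in>cell_matchings ?A ?B. \<Prod>c\<in>?A. if fst c = fst (f c) then a else 1)"
    using aztec_row_parity[of N] aztec_col_parity[of N]
    by (intro tiling_sum_cell_region[where e = "int N + 1"]) blast+
  also have "\<dots> = (\<Sum>\<pi>\<in>layered_perms N E. \<Prod>i<N * Suc N. edge_weight a N i (\<pi> i))"
    unfolding E(1)[symmetric] by (rule sum_matchings_eq_sum_layered_perms[OF R phi horizontal])
  finally have "complex_of_real (tiling_sum (cell_region (?A \<union> ?B)) a) =
      complex_of_real (\<Sum>\<pi>\<in>layered_perms N E. \<Prod>i<N * Suc N. edge_weight a N i (\<pi> i))" by simp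
  also have "\<dots> = (\<Sum>\<pi>\<in>layered_perms N E. \<Prod>i<N * Suc N. edge_weight (complex_of_real a) N i (\<pi> i))"
    by (simp add: edge_weight_def if_distrib cong: if_cong)
  also have "\<dots> = det (mat (N * Suc N) (N * Suc N) (\<lambda>(i, j). kasteleyn (complex_of_real a) N E i j))"
    using E(2) by (rule det_kasteleyn[symmetric])
  finally show ?thesis .
qed

lemma F_aztec_eq_det:
  "complex_of_real (F_aztec N a)
     = det (mat (N * Suc N) (N * Suc N) (\<lambda>(i, j). kasteleyn (complex_of_real a) N (edge N) i j))"
  using tiling_sum_eq_det[of "{}" N id a "edge N"]
  unfolding F_aztec_def aztec_diamond_cells aztec_cells by simp

text \<open>By \<open>cut_rows_forced\<close> it is enough to prescribe the edges of the cut rows on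
  diagonal \<open>m\<close>, although the removed region also covers later diagonals. So only
  \<open>m + 1 - k\<close> rows of the matrix change.\<close>

lemma F_reduced_eq_det:
  assumes m: "1 \<le> m" "m \<le> N" and k: "1 \<le> k" "k \<le> m + 1"
  shows "complex_of_real (F_reduced N m k a)
     = det (mat (N * Suc N) (N * Suc N) (\<lambda>(i, j). kasteleyn (complex_of_real a) N
         (\<lambda>i j. edge N i j \<and> (i \<in> cut_rows N m k \<and> i div N = m \<longrightarrow> j = cut_col N i)) i j))"
proof -
  let ?n = "N * Suc N" and ?R = "cut_rows N m k"
  let ?H = "{(i, l). i + l \<le> 2 * int m - int N - 3 \<or> l - i \<le> int N + 2 * int k - 2 * int m - 2}"
  let ?E = "\<lambda>i j. edge N i j \<and> (i \<in> ?R \<and> i div N = m \<longrightarrow> j = cut_col N i)"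
  have N: "0 < N" using m by simp
  have row: "row_cell N i \<in> ?H \<longleftrightarrow> i \<notin> ?R" if "i < ?n" for i
    using that k m by (auto simp: row_cell_def cut_rows_def)
  have col_set: "cut_col N ` ?R = {j. j < ?n \<and> m \<le> Suc (j div Suc N) \<and> N + k \<le> j mod Suc N + m}"
    (is "_ = ?S")
  proof
    show "cut_col N ` ?R \<subseteq> ?S"
    proof
      fix j assume "j \<in> cut_col N ` ?R"
      then obtain i where i: "i \<in> ?R" "j = cut_col N i" by blast
      then have "cut_col N i < ?n" using m by (intro cut_col_less) (auto simp: cut_rows_def)
      then show "j \<in> ?S"
        using i m by (auto simp: cut_rows_def cut_col_div_mod[OF N])
    qed
    show "?S \<subseteq> cut_col N ` ?R"
    proof
      fix j assume j: "j \<in> ?S"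
      define s p where "s = Suc (j div Suc N)" and "p = j mod Suc N - 1"
      have "j div Suc N < N" using j col_div_less by auto
      then have s: "s \<le> N" "m \<le> s" using j by (auto simp: s_def)
      have "j mod Suc N < Suc N" by simp
      then have p: "j mod Suc N = Suc p" "p < N" "N + k \<le> p + m + 1"
        using j k m unfolding p_def mem_Collect_eq by linarith+
      have "s * N + p \<in> ?R"
        using s p row_index[OF s(1) p(2)] by (auto simp: cut_rows_def)
      moreover have "cut_col N (s * N + p) = j"
        unfolding cut_col_def index_div_mod[OF p(2)] p(1)[symmetric] by (simp add: s_def del: mult_Suc_right)
      ultimately show "j \<in> cut_col N ` ?R" by force
    qed
  qed
  have col: "col_cell N j \<in> ?H \<longleftrightarrow> j \<notin> cut_col N ` ?R" if "j < ?n" for j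
    unfolding col_set using that k m by (auto simp: col_cell_def)
  have "(row_cell N ` {..<?n} \<union> col_cell N ` {..<?n}) \<inter> ?H
      = row_cell N ` ({..<?n} - ?R) \<union> col_cell N ` ({..<?n} - cut_col N ` ?R)"
  proof -
    have *: "f ` X \<inter> H = f ` (X - S)" if "\<And>i. i \<in> X \<Longrightarrow> f i \<in> H \<longleftrightarrow> i \<notin> S"
      for f :: "nat \<Rightarrow> cell" and X H S
      using that by blast
    show ?thesis
      unfolding Int_Un_distrib2 by (intro arg_cong2[of _ _ _ _ "(\<union>)"] *) (use row col in simp_all)
  qed
  then have "reduced_aztec_diamond N m k
      = cell_region (row_cell N ` ({..<?n} - ?R) \<union> col_cell N ` ({..<?n} - cut_col N ` ?R))"
    by (simp only: reduced_aztec_diamond_cells aztec_cells)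
  moreover have "layered_perms N (\<lambda>i j. edge N i j \<and> (i \<in> ?R \<longrightarrow> j = cut_col N i)) = layered_perms N ?E"
  proof (intro equalityI subsetI)
    fix \<pi> assume \<pi>: "\<pi> \<in> layered_perms N ?E"
    then have "\<pi> \<in> layered_perms N (edge N)" by (auto simp: layered_perms_def)
    then have "\<pi> i = cut_col N i" if "i \<in> ?R" for i
      by (rule cut_rows_forced[OF _ m(1)]) (use \<pi> that in \<open>auto simp: layered_perms_def cut_rows_def\<close>)
    then show "\<pi> \<in> layered_perms N (\<lambda>i j. edge N i j \<and> (i \<in> ?R \<longrightarrow> j = cut_col N i))"
      using \<pi> by (auto simp: layered_perms_def)
  qed (auto simp: layered_perms_def)
  moreover have "edge N i (cut_col N i) \<and> edge_weight a N i (cut_col N i) = 1" if "i \<in> ?R" for i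
    using that m cut_col_edge(1)[OF N, of i] cut_col_edge(2)[OF N, of i a] by (auto simp: cut_rows_def)
  moreover have "cut_col N ` ?R \<subseteq> {..<?n}" unfolding col_set by auto
  ultimately show ?thesis
    unfolding F_reduced_def
    using tiling_sum_eq_det[of ?R N "cut_col N" a ?E] inj_on_cut_col[OF m(1)]
    by (auto simp: cut_rows_def)
qed

section \<open>The quotient of the determinants\<close>

lemma sum_div_mod:
  fixes g :: "nat \<Rightarrow> 'a :: comm_monoid_add"
  shows "(\<Sum>i<S * N. g i) = (\<Sum>s<S. \<Sum>p<N. g (s * N + p))"
proof -
  have "sum g {s * N..<s * N + N} = (\<Sum>p<N. g (s * N + p))" for s
    using sum.shift_bounds_nat_ivl[of g 0 "s * N" N] by (simp add: atLeast0LessThan add.commute)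
  then show ?thesis by (simp flip: sum.nat_group)
qed

lemma coeff_linear_mult:
  "coeff ([:x, y:] * p) q = x * coeff p q + y * (if q = 0 then 0 else coeff p (q - 1))"
  for x :: "'a :: comm_ring_1"
  by (cases q) simp_all

text \<open>Reading a row of coefficients per diagonal as a polynomial, the Kasteleyn matrix multiplies
  by \<open>1 + a u\<close> along one diagonal and by \<open>\<plusminus>(u - a)\<close> along the other.\<close>

lemma kasteleyn_row_action:
  fixes f :: "nat \<Rightarrow> 'a :: comm_ring_1 poly"
  assumes deg: "\<And>s p. s \<le> N \<Longrightarrow> N \<le> p \<Longrightarrow> coeff (f s) p = 0" and b: "b < N" and q: "q \<le> N"
  shows "(\<Sum>i<N * Suc N. coeff (f (i div N)) (i mod N) * kasteleyn a N (edge N) i (b * Suc N + q))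
    = coeff ([:1, a:] * f b + (-1) ^ (b + N + 1) * ([:- a, 1:] * f (Suc b))) q"
proof -
  let ?j = "b * Suc N + q"
  have j: "?j div Suc N = b" "?j mod Suc N = q"
    using index_div_mod[of q "Suc N" b] q by simp_all
  \<comment> \<open>On backward edges \<open>i + j\<close> has the parity of
    \<open>b + N + (q - p)\<close>, so the two entries are \<open>e * a\<close> and
    \<open>- e\<close>: one sign for the diagonal, and an alternation that turns
    \<open>a + u\<close> into \<open>a - u\<close>.\<close>
  define e :: 'a where "e = (-1) ^ (b + N)"
  have k: "kasteleyn a N (edge N) (s * N + p) ?j =
      (if s = b then (if q = p then 1 else if q = Suc p then a else 0)
       else if s = Suc b then (if q = p then e * a else if q = Suc p then - e else 0) else 0)"
    if "p < N" for s p
  proof (cases "s = Suc b")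
    case True
    have "Suc b * N + p + (b * Suc N + p) = 2 * (b * N + p) + (b + N)"
      "Suc b * N + p + (b * Suc N + Suc p) = 2 * (b * N + p) + (b + N) + 1"
      by simp_all
    then have "(-1) ^ (Suc b * N + p + (b * Suc N + p)) = e"
      "(-1) ^ (Suc b * N + p + (b * Suc N + Suc p)) = - e"
      unfolding e_def by (simp_all only: power_add power_mult) simp_all
    then show ?thesis
      using True unfolding kasteleyn_def edge_def edge_weight_def j index_div_mod[OF that] by auto
  next
    case False
    then show ?thesis
      unfolding kasteleyn_def edge_def edge_weight_def j index_div_mod[OF that] by auto
  qed
  \<comment> \<open>The sum stops before \<open>N\<close>, but the further coefficients of
    \<open>g\<close> vanish, so it is the full coefficient of the product even at
    \<open>q = N\<close>.\<close>
  have lin: "(\<Sum>p<N. coeff g p * (if q = p then x else if q = Suc p then y else 0)) = coeff ([:x, y:] * g) q"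
    if "\<And>p. N \<le> p \<Longrightarrow> coeff g p = 0" for g and x y :: 'a
  proof -
    have "(\<Sum>p<N. coeff g p * (if q = p then x else if q = Suc p then y else 0))
       = (\<Sum>p<N. (if p = q then x * coeff g q else 0) + (if p = q - 1 then (if q = 0 then 0 else y * coeff g (q - 1)) else 0))"
      by (intro sum.cong refl) auto
    also have "\<dots> = coeff ([:x, y:] * g) q"
      unfolding sum.distrib coeff_linear_mult using that[of q] q by (auto simp: sum.delta)
    finally show ?thesis .
  qed
  have "(\<Sum>i<N * Suc N. coeff (f (i div N)) (i mod N) * kasteleyn a N (edge N) i ?j)
      = (\<Sum>s<Suc N. \<Sum>p<N. coeff (f s) p * kasteleyn a N (edge N) (s * N + p) ?j)"
    unfolding mult.commute[of N "Suc N"] sum_div_mod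
    by (intro sum.cong refl) (simp add: index_div_mod del: mult_Suc mult_Suc_right)
  also have "\<dots> = (\<Sum>s<Suc N. (if s = b then \<Sum>p<N. coeff (f s) p * (if q = p then 1 else if q = Suc p then a else 0) else 0)
      + (if s = Suc b then \<Sum>p<N. coeff (f s) p * (if q = p then e * a else if q = Suc p then - e else 0) else 0))"
  proof (rule sum.cong[OF refl])
    fix s
    have "(\<Sum>p<N. coeff (f s) p * kasteleyn a N (edge N) (s * N + p) ?j) = (\<Sum>p<N. coeff (f s) p *
      (if s = b then (if q = p then 1 else if q = Suc p then a else 0)
       else if s = Suc b then (if q = p then e * a else if q = Suc p then - e else 0) else 0))"
      by (rule sum.cong[OF refl]) (simp only: k lessThan_iff)
    then show "(\<Sum>p<N. coeff (f s) p * kasteleyn a N (edge N) (s * N + p) ?j)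
      = (if s = b then \<Sum>p<N. coeff (f s) p * (if q = p then 1 else if q = Suc p then a else 0) else 0)
      + (if s = Suc b then \<Sum>p<N. coeff (f s) p * (if q = p then e * a else if q = Suc p then - e else 0) else 0)"
      by (cases "s = b"; cases "s = Suc b") simp_all
  qed
  also have "\<dots> = (\<Sum>p<N. coeff (f b) p * (if q = p then 1 else if q = Suc p then a else 0))
      + (\<Sum>p<N. coeff (f (Suc b)) p * (if q = p then e * a else if q = Suc p then - e else 0))"
    using b by (simp only: sum.distrib sum.delta finite_lessThan lessThan_iff less_SucI Suc_less_eq if_True)
  also have "\<dots> = coeff ([:1, a:] * f b) q + coeff ([:e * a, - e:] * f (Suc b)) q"
    by (intro arg_cong2[of _ _ _ _ "(+)"] lin deg) (use b in simp_all)
  also have "coeff ([:1, a:] * f b) q + coeff ([:e * a, - e:] * f (Suc b)) q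
     = coeff ([:1, a:] * f b + (-1) ^ (b + N + 1) * ([:- a, 1:] * f (Suc b))) q"
  proof -
    have "[:e * a, - e:] = (-1) ^ (b + N + 1) * [:- a, 1:]"
      by (cases "even (b + N)") (auto simp: e_def)
    then show ?thesis by (simp only: mult.assoc coeff_add)
  qed
  finally show ?thesis .
qed

text \<open>The unit rows before the block make \<open>L\<close> block lower triangular, those after
  it make the remaining corner block upper triangular; the middle block is all that counts.\<close>

lemma det_identity_outside_block:
  fixes L :: "'a :: idom mat"
  assumes L: "L \<in> carrier_mat n n" and o: "o1 + r \<le> n"
    and id: "\<And>i j. i < n \<Longrightarrow> j < n \<Longrightarrow> i \<notin> {o1..<o1 + r} \<Longrightarrow> L $$ (i, j) = (if i = j then 1 else 0)"
  shows "det L = det (mat r r (\<lambda>(x, y). L $$ (o1 + x, o1 + y)))"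
proof -
  define l where "l = n - (o1 + r)"
  have n: "n = o1 + (r + l)" using o by (simp add: l_def)
  let ?G = "mat r r (\<lambda>(x, y). L $$ (o1 + x, o1 + y))"
  let ?B = "mat r l (\<lambda>(x, y). L $$ (o1 + x, o1 + r + y))"
  let ?A4 = "four_block_mat ?G ?B (0\<^sub>m l r) (1\<^sub>m l)"
  let ?A3 = "mat (r + l) o1 (\<lambda>(x, y). L $$ (o1 + x, y))"
  have "L = four_block_mat (1\<^sub>m o1) (0\<^sub>m o1 (r + l)) ?A3 ?A4"
  proof (rule eq_matI)
    fix i j assume "i < dim_row (four_block_mat (1\<^sub>m o1) (0\<^sub>m o1 (r + l)) ?A3 ?A4)"
      "j < dim_col (four_block_mat (1\<^sub>m o1) (0\<^sub>m o1 (r + l)) ?A3 ?A4)"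
    then have ij: "i < n" "j < n" by (auto simp: n)
    consider "i < o1" | "o1 \<le> i" "i < o1 + r" | "o1 + r \<le> i" by linarith
    then show "L $$ (i, j) = four_block_mat (1\<^sub>m o1) (0\<^sub>m o1 (r + l)) ?A3 ?A4 $$ (i, j)"
      by cases (use ij id[OF ij] in \<open>auto simp: n\<close>)
  qed (use L n in auto)
  then have "det L = det (1\<^sub>m o1) * det ?A4"
    by (subst (asm) eq_commute, elim subst) (rule det_four_block_mat_upper_right_zero[of _ o1 _ "r + l"]; simp)
  also have "det ?A4 = det ?G * det (1\<^sub>m l)"
    by (rule det_four_block_mat_lower_left_zero[of _ r _ l]; simp)
  finally show ?thesis by simp
qed

text \<open>With \<open>h\<close> a power of \<open>u\<close> this gives the rows of the inverse Kasteleyn matrix: away from the source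
  diagonal \<open>m - 1\<close> the homogeneous recurrence forces all factors but \<open>P\<close> and \<open>Q\<close>.\<close>

lemma kasteleyn_source_solution:
  fixes a :: "'a :: idom"
  assumes m: "1 \<le> m" "m \<le> N"
    and PQ: "[:1, a:] ^ m * P + [:- a, 1:] ^ (N - m + 1) * Q = h"
    and deg: "degree P \<le> N - m" "degree Q < m"
  obtains f where "\<And>s p. s \<le> N \<Longrightarrow> N \<le> p \<Longrightarrow> coeff (f s) p = 0" "f m = [:- a, 1:] ^ (N - m) * Q"
    "\<And>b. b < N \<Longrightarrow> [:1, a:] * f b + (-1) ^ (b + N + 1) * ([:- a, 1:] * f (Suc b))
        = (if Suc b = m then (-1) ^ (m + N) * h else 0)"
proof -
  \<comment> \<open>\<open>\<tau>\<close> accumulates the signs of the recurrence: for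
    \<open>f b = \<tau> b * g b\<close> it reads \<open>(1 + a u) g b = (u - a) g (Suc b)\<close>
    away from the source.\<close>
  define \<tau> :: "nat \<Rightarrow> 'a poly" where "\<tau> b = (\<Prod>j<b. (-1) ^ (j + N))" for b
  have \<tau>_Suc: "\<tau> (Suc b) = \<tau> b * (-1) ^ (b + N)" for b by (simp add: \<tau>_def)
  have \<tau>_sq: "\<tau> b * \<tau> b = 1" for b
  proof (induction b)
    case (Suc b)
    have "\<tau> (Suc b) * \<tau> (Suc b) = (\<tau> b * \<tau> b) * ((-1) ^ (b + N) * (-1) ^ (b + N))"
      unfolding \<tau>_Suc by (simp only: ac_simps)
    then show ?case unfolding Suc power_mult_distrib[symmetric] by simp
  qed (simp add: \<tau>_def)
  have deg_lin: "degree [:1, a:] \<le> 1" "degree [:- a, 1:] \<le> 1" by auto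
  have deg_\<tau>: "degree (\<tau> b) = 0" for b
  proof -
    have "\<tau> b = 1 \<or> \<tau> b = -1"
    proof (induction b)
      case (Suc b)
      then show ?case unfolding \<tau>_Suc by (cases "even (b + N)") auto
    qed (simp add: \<tau>_def)
    then show ?thesis by auto
  qed
  \<comment> \<open>Each diagonal trades one factor \<open>u - a\<close> for one factor
    \<open>1 + a u\<close>, so the degree stays below \<open>N\<close> on both sides of the source.
    The \<open>-1\<close> before \<open>P\<close> makes the jump at \<open>m - 1\<close> the sum of
    the two terms of \<open>PQ\<close>, and \<open>\<tau> m\<close> normalises
    \<open>f m\<close>.\<close>
  define f where "f b = (if m \<le> b then \<tau> b * \<tau> m * ([:1, a:] ^ (b - m) * [:- a, 1:] ^ (N - b) * Q)
    else \<tau> b * \<tau> m * ((-1) * [:1, a:] ^ b * [:- a, 1:] ^ (m - 1 - b) * P))" for b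
  show thesis
  proof (rule that[of f])
    show "f m = [:- a, 1:] ^ (N - m) * Q" by (simp add: f_def \<tau>_sq)
    show "coeff (f s) p = 0" if "s \<le> N" "N \<le> p" for s p
    proof -
      have pw: "degree ([:1, a:] ^ i) \<le> i" "degree ([:- a, 1:] ^ i) \<le> i" for i
        using degree_power_le[of "[:1, a:]" i] degree_power_le[of "[:- a, 1:]" i] deg_lin
        by (auto elim: order_trans)
      have "degree (f s) < N"
      proof (cases "m \<le> s")
        case True
        have "degree (f s) \<le> degree (\<tau> s * \<tau> m) + (degree ([:1, a:] ^ (s - m)) + degree ([:- a, 1:] ^ (N - s)) + degree Q)"
          using True by (simp add: f_def) (meson add_left_mono add_right_mono degree_mult_le order_trans)
        also have "degree (\<tau> s * \<tau> m) = 0" using degree_mult_le[of "\<tau> s" "\<tau> m"] by (simp add: deg_\<tau>)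
        finally show ?thesis using pw(1)[of "s - m"] pw(2)[of "N - s"] deg m True that by linarith
      next
        case False
        have "degree (f s) \<le> degree (\<tau> s * \<tau> m) + (degree ([:1, a:] ^ s) + degree ([:- a, 1:] ^ (m - 1 - s)) + degree P)"
          using False by (simp add: f_def) (meson add_left_mono add_right_mono degree_mult_le order_trans)
        also have "degree (\<tau> s * \<tau> m) = 0" using degree_mult_le[of "\<tau> s" "\<tau> m"] by (simp add: deg_\<tau>)
        finally show ?thesis using pw(1)[of s] pw(2)[of "m - 1 - s"] deg m False that by linarith
      qed
      then show ?thesis using that by (intro coeff_eq_0) simp
    qed
    show "[:1, a:] * f b + (-1) ^ (b + N + 1) * ([:- a, 1:] * f (Suc b))
        = (if Suc b = m then (-1) ^ (m + N) * h else 0)" if b: "b < N" for b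
    proof -
      define x y where "x = [:1, a:]" and "y = [:- a, 1:]"
      have sgn: "(-1) ^ (b + N + 1) * \<tau> (Suc b) = - \<tau> b"
        unfolding \<tau>_Suc by (simp add: mult.left_commute flip: power_add mult_2)
      consider "Suc b < m" | "Suc b = m" | "m \<le> b" by linarith
      then show ?thesis
      proof cases
        case 1
        then have e: "m - 1 - b = Suc (m - 1 - Suc b)" by simp
        have "x * f b + (-1) ^ (b + N + 1) * (y * f (Suc b))
          = x * f b + ((-1) ^ (b + N + 1) * \<tau> (Suc b)) * (\<tau> m * (- 1) * y * x ^ Suc b * y ^ (m - 1 - Suc b) * P)"
          using 1 by (simp add: f_def x_def[symmetric] y_def[symmetric] algebra_simps)
        also have "\<dots> = 0"
          unfolding sgn using 1 e by (simp add: f_def x_def[symmetric] y_def[symmetric] algebra_simps)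
        finally show ?thesis using 1 unfolding x_def y_def by simp
      next
        case 2
        have \<tau>m: "\<tau> b * \<tau> m = (-1) ^ (b + N)"
          using \<tau>_sq[of b] unfolding 2[symmetric] \<tau>_Suc by (simp add: mult.assoc[symmetric])
        have "x * f b + (-1) ^ (b + N + 1) * (y * f m)
          = (\<tau> b * \<tau> m) * (-1) * (x ^ Suc b * P) + (-1) ^ (b + N + 1) * (y ^ (N - m + 1) * Q)"
          using 2 \<tau>_sq[of m] by (auto simp: f_def x_def[symmetric] y_def[symmetric] algebra_simps)
        also have "\<dots> = (-1) ^ (b + N + 1) * h"
          unfolding \<tau>m PQ[symmetric] 2 x_def y_def by (simp add: algebra_simps)
        finally show ?thesis using 2 unfolding x_def y_def by auto
      next
        case 3
        then have e: "N - b = Suc (N - Suc b)" "Suc b - m = Suc (b - m)" using b by auto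
        have "x * f b + (-1) ^ (b + N + 1) * (y * f (Suc b))
          = x * f b + ((-1) ^ (b + N + 1) * \<tau> (Suc b)) * (\<tau> m * y * x ^ (Suc b - m) * y ^ (N - Suc b) * Q)"
          using 3 by (simp add: f_def x_def[symmetric] y_def[symmetric] algebra_simps)
        also have "\<dots> = 0"
          unfolding sgn using 3 e by (simp add: f_def x_def[symmetric] y_def[symmetric] algebra_simps)
        finally show ?thesis using 3 unfolding x_def y_def by simp
      qed
    qed
  qed
qed


text \<open>Combining the rows of the full matrix with the coefficients of a source solution leaves
  a single nonzero entry, at the left neighbour of a cut square. So \<open>L\<close>, with these
  coefficients in the cut rows on diagonal \<open>m\<close> and unit rows elsewhere, multiplies the
  full matrix into the cut one. Its determinant sees only the columns of those same indices, where
  the solution is \<open>f m\<close>.\<close>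

lemma det_cut_kasteleyn:
  fixes a :: "'a :: idom" and P Q :: "nat \<Rightarrow> 'a poly"
  assumes m: "1 \<le> m" "m \<le> N" and k: "1 \<le> k" "k \<le> m + 1"
    and PQ: "\<And>x. x < m + 1 - k \<Longrightarrow>
      [:1, a:] ^ m * P x + [:- a, 1:] ^ (N - m + 1) * Q x = monom 1 (N - m + k + x)"
    and deg: "\<And>x. x < m + 1 - k \<Longrightarrow> degree (P x) \<le> N - m \<and> degree (Q x) < m"
  shows "det (mat (N * Suc N) (N * Suc N) (\<lambda>(i, j). kasteleyn a N
         (\<lambda>i j. edge N i j \<and> (i \<in> cut_rows N m k \<and> i div N = m \<longrightarrow> j = cut_col N i)) i j))
    = det (mat (m + 1 - k) (m + 1 - k) (\<lambda>(x, y). coeff ([:- a, 1:] ^ (N - m) * Q x) (N - m + k - 1 + y)))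
      * det (mat (N * Suc N) (N * Suc N) (\<lambda>(i, j). kasteleyn a N (edge N) i j))"
proof -
  let ?n = "N * Suc N" and ?E = "\<lambda>i j. edge N i j \<and> (i \<in> cut_rows N m k \<and> i div N = m \<longrightarrow> j = cut_col N i)"
  define r t o1 where "r = m + 1 - k" and "t = N - m + k - 1" and "o1 = m * N + t"
  have N: "0 < N" using m by simp
  have tr: "t + r = N" using m k by (simp add: r_def t_def)
  have "\<forall>x. \<exists>f. x < r \<longrightarrow> (\<forall>s p. s \<le> N \<longrightarrow> N \<le> p \<longrightarrow> coeff (f s) p = 0) \<and> f m = [:- a, 1:] ^ (N - m) * Q x \<and>
    (\<forall>b<N. [:1, a:] * f b + (-1) ^ (b + N + 1) * ([:- a, 1:] * f (Suc b))
        = (if Suc b = m then (-1) ^ (m + N) * monom 1 (N - m + k + x) else 0))"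
  proof
    fix x
    show "\<exists>f. x < r \<longrightarrow> (\<forall>s p. s \<le> N \<longrightarrow> N \<le> p \<longrightarrow> coeff (f s) p = 0) \<and> f m = [:- a, 1:] ^ (N - m) * Q x \<and>
      (\<forall>b<N. [:1, a:] * f b + (-1) ^ (b + N + 1) * ([:- a, 1:] * f (Suc b))
          = (if Suc b = m then (-1) ^ (m + N) * monom 1 (N - m + k + x) else 0))"
    proof (cases "x < r")
      case True
      then have x: "x < m + 1 - k" by (simp add: r_def)
      obtain f where "\<And>s p. s \<le> N \<Longrightarrow> N \<le> p \<Longrightarrow> coeff (f s) p = 0" "f m = [:- a, 1:] ^ (N - m) * Q x"
        "\<And>b. b < N \<Longrightarrow> [:1, a:] * f b + (-1) ^ (b + N + 1) * ([:- a, 1:] * f (Suc b))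
          = (if Suc b = m then (-1) ^ (m + N) * monom 1 (N - m + k + x) else 0)"
        using kasteleyn_source_solution[OF m PQ[OF x]] deg[OF x] by blast
      then show ?thesis by blast
    qed simp
  qed
  then obtain f where f0: "\<forall>x. x < r \<longrightarrow> (\<forall>s p. s \<le> N \<longrightarrow> N \<le> p \<longrightarrow> coeff (f x s) p = 0) \<and>
     f x m = [:- a, 1:] ^ (N - m) * Q x \<and>
    (\<forall>b<N. [:1, a:] * f x b + (-1) ^ (b + N + 1) * ([:- a, 1:] * f x (Suc b))
        = (if Suc b = m then (-1) ^ (m + N) * monom 1 (N - m + k + x) else 0))"
    by (rule choice[THEN exE])
  have f: "\<And>x s p. x < r \<Longrightarrow> s \<le> N \<Longrightarrow> N \<le> p \<Longrightarrow> coeff (f x s) p = 0"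
     "\<And>x. x < r \<Longrightarrow> f x m = [:- a, 1:] ^ (N - m) * Q x"
    "\<And>x b. x < r \<Longrightarrow> b < N \<Longrightarrow> [:1, a:] * f x b + (-1) ^ (b + N + 1) * ([:- a, 1:] * f x (Suc b))
        = (if Suc b = m then (-1) ^ (m + N) * monom 1 (N - m + k + x) else 0)"
    using f0 by blast+
  define L where "L = mat ?n ?n (\<lambda>(i, j). if i \<in> {o1..<o1 + r} then coeff (f (i - o1) (j div N)) (j mod N)
    else if i = j then 1 else 0)"
  define K where "K = mat ?n ?n (\<lambda>(i, j). kasteleyn a N (edge N) i j)"
  have o: "o1 + r \<le> ?n"
    unfolding o1_def mult_Suc_right using mult_le_mono1[OF m(2), of N] tr by linarith
  have rows: "o1 + x < ?n" "(o1 + x) div N = m" "(o1 + x) mod N = t + x" if "x < r" for x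
  proof -
    show "o1 + x < ?n" using o that by linarith
    show "(o1 + x) div N = m" "(o1 + x) mod N = t + x"
      using index_div_mod[of "t + x" N m] that tr by (simp_all add: o1_def add.assoc)
  qed
  have cut: "i \<in> cut_rows N m k \<and> i div N = m \<longleftrightarrow> i \<in> {o1..<o1 + r}" if "i < ?n" for i
  proof
    assume *: "i \<in> cut_rows N m k \<and> i div N = m"
    then have "i = m * N + i mod N" using div_mult_mod_eq[of i N] by simp
    moreover have "i mod N < N" using N by simp
    moreover have "t \<le> i mod N" using * m k by (auto simp: t_def cut_rows_def)
    ultimately show "i \<in> {o1..<o1 + r}" using tr unfolding o1_def atLeastLessThan_iff by linarith
  next
    assume "i \<in> {o1..<o1 + r}"
    then obtain x where "x < r" "i = o1 + x" by (metis add_less_cancel_left atLeastLessThan_iff le_Suc_ex)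
    then show "i \<in> cut_rows N m k \<and> i div N = m"
      using rows m k by (auto simp: cut_rows_def t_def)
  qed
  have "L * K = mat ?n ?n (\<lambda>(i, j). kasteleyn a N ?E i j)"
  proof (rule eq_matI)
    fix i j assume "i < dim_row (mat ?n ?n (\<lambda>(i, j). kasteleyn a N ?E i j))"
      "j < dim_col (mat ?n ?n (\<lambda>(i, j). kasteleyn a N ?E i j))"
    then have ij: "i < ?n" "j < ?n" by simp_all
    have prod: "(L * K) $$ (i, j) = (\<Sum>l<?n. L $$ (i, l) * kasteleyn a N (edge N) l j)"
      using ij by (simp add: times_mat_def scalar_prod_def K_def L_def atLeast0LessThan del: mult_Suc_right)
    show "(L * K) $$ (i, j) = mat ?n ?n (\<lambda>(i, j). kasteleyn a N ?E i j) $$ (i, j)"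
    proof (cases "i \<in> {o1..<o1 + r}")
      case False
      have "(\<Sum>l<?n. L $$ (i, l) * kasteleyn a N (edge N) l j)
          = (\<Sum>l<?n. if l = i then kasteleyn a N (edge N) i j else 0)"
        using ij False by (intro sum.cong refl) (auto simp: L_def simp del: mult_Suc_right)
      also have "\<dots> = kasteleyn a N ?E i j"
        using ij False cut[OF ij(1)] by (auto simp: kasteleyn_def simp del: mult_Suc_right)
      finally show ?thesis using ij by (simp add: prod del: mult_Suc_right)
    next
      case True
      then obtain x where x: "x < r" "i = o1 + x" by (metis add_less_cancel_left atLeastLessThan_iff le_Suc_ex)
      define b q where "b = j div Suc N" and "q = j mod Suc N"
      have bq: "b < N" "q \<le> N" "j = b * Suc N + q"
        using col_div_less[OF ij(2)] div_mult_mod_eq[of j "Suc N"] mod_less_divisor[of "Suc N" j]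
        by (simp_all add: b_def q_def del: mult_Suc_right mod_less_divisor)
      have "(\<Sum>l<?n. L $$ (i, l) * kasteleyn a N (edge N) l j)
          = (\<Sum>l<?n. coeff (f x (l div N)) (l mod N) * kasteleyn a N (edge N) l (b * Suc N + q))"
        using ij True unfolding bq(3)[symmetric]
        by (intro sum.cong refl) (auto simp: L_def x(2) simp del: mult_Suc_right)
      also have "\<dots> = coeff (if Suc b = m then (-1) ^ (m + N) * monom 1 (N - m + k + x) else 0) q"
        using f(3)[OF x(1) bq(1)] kasteleyn_row_action[of N "f x" b q a] f(1)[OF x(1)] bq by simp
      also have "\<dots> = (if Suc b = m \<and> q = Suc (t + x) then (-1) ^ (m + N) else 0)"
      proof -
        \<comment> \<open>The row at position \<open>t + x\<close> has its left neighbour at column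
          position \<open>t + x + 1\<close>; this is the exponent of the source monomial.\<close>
        have "N - m + k + x = Suc (t + x)" using k by (simp add: t_def)
        moreover have "(-1) ^ (m + N) * p = (if even (m + N) then p else - p)" for p :: "'a poly" by simp
        ultimately show ?thesis by auto
      qed
      also have "\<dots> = kasteleyn a N ?E i j"
      proof -
        have im: "i div N = m" "i mod N = t + x" using rows[OF x(1)] by (simp_all add: x(2))
        have "j = cut_col N i \<longleftrightarrow> Suc b = m \<and> q = Suc (t + x)"
        proof
          assume "j = cut_col N i"
          then show "Suc b = m \<and> q = Suc (t + x)"
            using cut_col_div_mod[OF N, of i] m im by (simp add: b_def q_def)
        next
          assume "Suc b = m \<and> q = Suc (t + x)"
          then show "j = cut_col N i" unfolding cut_col_def im bq(3) by auto
        qed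
        \<comment> \<open>The sign carried by the source is exactly the Kasteleyn sign of this edge,
          so no correction factor remains.\<close>
        moreover have "kasteleyn a N (edge N) i (cut_col N i) = (-1) ^ (m + N)"
        proof -
          have "i + cut_col N i = 2 * (m * N + t + x - N) + (m + N)"
          proof -
            have "i = m * N + (t + x)" by (simp add: x(2) o1_def)
            moreover have "cut_col N i = (m - 1) * Suc N + Suc (t + x)" unfolding cut_col_def im ..
            moreover obtain m' where "m = Suc m'" using m by (cases m) auto
            ultimately show ?thesis by simp
          qed
          then have "(-1) ^ (i + cut_col N i) = ((-1) ^ (m + N) :: 'a)"
            by (simp only: power_add power_mult) simp
          then show ?thesis
            using cut_col_edge[OF N, of i] cut_col_div_mod[OF N, of i] m
            by (simp add: kasteleyn_def im cut_col_edge(2)[OF N])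
        qed
        ultimately show ?thesis
          using cut[OF ij(1)] True cut_col_edge(1)[OF N, of i] m im by (auto simp: kasteleyn_def)
      qed
      finally show ?thesis using ij by (simp add: prod del: mult_Suc_right)
    qed
  qed (simp_all add: L_def K_def del: mult_Suc_right)
  moreover have "det (L * K) = det L * det K"
    by (rule det_mult[of _ ?n]) (simp_all add: L_def K_def del: mult_Suc_right)
  moreover have "det L = det (mat r r (\<lambda>(x, y). L $$ (o1 + x, o1 + y)))"
    by (rule det_identity_outside_block[OF _ o]) (auto simp: L_def simp del: mult_Suc_right)
  moreover have "mat r r (\<lambda>(x, y). L $$ (o1 + x, o1 + y))
      = mat r r (\<lambda>(x, y). coeff ([:- a, 1:] ^ (N - m) * Q x) (t + y))"
    by (rule eq_matI) (use rows f(2) in \<open>auto simp: L_def simp del: mult_Suc_right\<close>)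
  ultimately show ?thesis by (simp only: K_def r_def t_def)
qed

text \<open>Supplies the factor \<open>u - a\<close> that separates the solution on diagonal
  \<open>m\<close> from the second term of the partial fraction identity. On coefficients this
  factor acts by a bidiagonal matrix; only the last column would need an entry beyond the block, and
  \<open>top\<close> makes that entry zero.\<close>

lemma det_coeff_shift:
  fixes a :: "'a :: idom" and g :: "nat \<Rightarrow> 'a poly"
  assumes top: "\<And>x. x < r \<Longrightarrow> coeff (g x) (t + r) = 0"
  shows "det (mat r r (\<lambda>(x, y). coeff (g x) (t + y)))
    = det (mat r r (\<lambda>(x, y). coeff ([:- a, 1:] * g x) (t + 1 + y)))"
proof -
  \<comment> \<open>the two matrices differ by a unitriangular factor\<close>
  let ?G = "mat r r (\<lambda>(x, y). coeff (g x) (t + y))"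
  define U where "U = mat r r (\<lambda>(z, y). if z = y then 1 else if z = Suc y then - a else 0)"
  have "?G * U = mat r r (\<lambda>(x, y). coeff ([:- a, 1:] * g x) (t + 1 + y))"
  proof (rule eq_matI)
    fix x y assume "x < dim_row (mat r r (\<lambda>(x, y). coeff ([:- a, 1:] * g x) (t + 1 + y)))"
      "y < dim_col (mat r r (\<lambda>(x, y). coeff ([:- a, 1:] * g x) (t + 1 + y)))"
    then have xy: "x < r" "y < r" by simp_all
    have "(?G * U) $$ (x, y) = (\<Sum>z<r. coeff (g x) (t + z) * (if z = y then 1 else if z = Suc y then - a else 0))"
      using xy by (simp add: times_mat_def scalar_prod_def U_def atLeast0LessThan)
    also have "\<dots> = (\<Sum>z<r. (if z = y then coeff (g x) (t + y) else 0)
        + (if z = Suc y then - a * coeff (g x) (t + Suc y) else 0))"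
      by (intro sum.cong refl) auto
    also have "\<dots> = coeff (g x) (t + y) - a * coeff (g x) (t + Suc y)"
    proof (cases "Suc y < r")
      case True
      then show ?thesis using xy by (simp add: sum.distrib)
    next
      case False
      then have "Suc y = r" using xy by simp
      then show ?thesis using xy top[OF xy(1)] by (simp add: sum.distrib)
    qed
    finally show "(?G * U) $$ (x, y) = mat r r (\<lambda>(x, y). coeff ([:- a, 1:] * g x) (t + 1 + y)) $$ (x, y)"
      using xy by simp
  qed (simp_all add: U_def)
  moreover have "det (?G * U) = det ?G * det U"
    by (rule det_mult[of _ r]) (simp_all add: U_def)
  moreover have "det U = 1"
  proof -
    have "det U = prod_list (diag_mat U)"
      by (rule det_lower_triangular[of r]) (auto simp: U_def)
    also have "diag_mat U = map (\<lambda>_. 1) [0..<r]"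
      by (auto simp: diag_mat_def U_def)
    also have "prod_list \<dots> = 1" by (induction r) simp_all
    finally show ?thesis .
  qed
  ultimately show ?thesis by simp
qed

lemma F_reduced_eq_F_aztec_det:
  fixes P Q :: "nat \<Rightarrow> complex poly"
  assumes m: "1 \<le> m" "m \<le> N" and k: "1 \<le> k" "k \<le> m + 1"
    and PQ: "\<And>x. x < m + 1 - k \<Longrightarrow> [:1, complex_of_real a:] ^ m * P x
      + [:- complex_of_real a, 1:] ^ (N - m + 1) * Q x = monom 1 (N - m + k + x)"
    and deg: "\<And>x. x < m + 1 - k \<Longrightarrow> degree (P x) \<le> N - m \<and> degree (Q x) < m"
  shows "complex_of_real (F_reduced N m k a) = complex_of_real (F_aztec N a) *
     det (mat (m + 1 - k) (m + 1 - k) (\<lambda>(x, y). (if x = y then 1 else 0)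
       - coeff ([:1, complex_of_real a:] ^ m * P x) (N - m + k + y)))"
proof -
  let ?a = "complex_of_real a" and ?r = "m + 1 - k"
  have "det (mat ?r ?r (\<lambda>(x, y). coeff ([:- ?a, 1:] ^ (N - m) * Q x) (N - m + k - 1 + y)))
      = det (mat ?r ?r (\<lambda>(x, y). coeff ([:- ?a, 1:] * ([:- ?a, 1:] ^ (N - m) * Q x)) (N - m + k - 1 + 1 + y)))"
  proof (rule det_coeff_shift)
    fix x assume x: "x < ?r"
    have "degree ([:- ?a, 1:] ^ (N - m) * Q x) \<le> (N - m) + degree (Q x)"
      by (rule order_trans[OF degree_mult_le]) (simp add: degree_linear_power)
    also have "\<dots> < N" using deg[OF x] m by linarith
    \<comment> \<open>The first index after the block is exactly \<open>N\<close>, so the degree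
      bound yields the vanishing required by \<open>det_coeff_shift\<close>.\<close>
    also have "N = N - m + k - 1 + ?r" using m k by simp
    finally show "coeff ([:- ?a, 1:] ^ (N - m) * Q x) (N - m + k - 1 + ?r) = 0"
      by (rule coeff_eq_0)
  qed
  also have "mat ?r ?r (\<lambda>(x, y). coeff ([:- ?a, 1:] * ([:- ?a, 1:] ^ (N - m) * Q x)) (N - m + k - 1 + 1 + y))
     = mat ?r ?r (\<lambda>(x, y). (if x = y then 1 else 0) - coeff ([:1, ?a:] ^ m * P x) (N - m + k + y))"
  proof (rule eq_matI)
    fix x y assume "x < dim_row (mat ?r ?r (\<lambda>(x, y). (if x = y then 1 else 0) - coeff ([:1, ?a:] ^ m * P x) (N - m + k + y)))"
      "y < dim_col (mat ?r ?r (\<lambda>(x, y). (if x = y then 1 else 0) - coeff ([:1, ?a:] ^ m * P x) (N - m + k + y)))"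
    then have xy: "x < ?r" "y < ?r" by simp_all
    have *: "[:- ?a, 1:] * ([:- ?a, 1:] ^ (N - m) * Q x) = monom 1 (N - m + k + x) - [:1, ?a:] ^ m * P x"
      unfolding PQ[OF xy(1), symmetric]
      by (simp only: add_diff_cancel_left' Suc_eq_plus1[symmetric] power_Suc mult.assoc)
    have idx: "N - m + k - 1 + 1 + y = N - m + k + y" using k by simp
    have "coeff (monom 1 (N - m + k + x)) (N - m + k + y) = (if x = y then 1 else (0 :: complex))"
      by auto
    then show "mat ?r ?r (\<lambda>(x, y). coeff ([:- ?a, 1:] * ([:- ?a, 1:] ^ (N - m) * Q x)) (N - m + k - 1 + 1 + y)) $$ (x, y)
      = mat ?r ?r (\<lambda>(x, y). (if x = y then 1 else 0) - coeff ([:1, ?a:] ^ m * P x) (N - m + k + y)) $$ (x, y)"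
      unfolding index_mat(1)[OF xy] prod.case idx * coeff_diff by simp
  qed simp_all
  finally have G: "det (mat ?r ?r (\<lambda>(x, y). coeff ([:- ?a, 1:] ^ (N - m) * Q x) (N - m + k - 1 + y)))
    = det (mat ?r ?r (\<lambda>(x, y). (if x = y then 1 else 0) - coeff ([:1, ?a:] ^ m * P x) (N - m + k + y)))" .
  show ?thesis
    unfolding F_reduced_eq_det[OF m k] F_aztec_eq_det G[symmetric]
    by (subst mult.commute, rule det_cut_kasteleyn[OF m k PQ deg])
qed

section \<open>The kernel by residues\<close>

text \<open>Coprimality with a fixed element passes to products, hence to powers of
  \<open>A\<close>, and then, with the roles exchanged, to powers of \<open>B\<close>.\<close>

lemma bezout_powers:
  fixes A B :: "'a :: comm_ring_1"
  assumes "x * A + y * B = 1"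
  shows "\<exists>x y. x * A ^ m + y * B ^ n = 1"
proof -
  have step: "\<exists>x y. x * (A * C) + y * B = 1" if "x * A + y * B = 1" "z * C + w * B = 1"
    for A B C x y z w :: 'a
  proof -
    have "(x * z) * (A * C) + (x * A * w + y) * B = x * A * (z * C + w * B) + y * B"
      by (simp add: algebra_simps)
    also have "\<dots> = 1" using that by simp
    finally show ?thesis by blast
  qed
  have pow: "\<exists>x y. x * A ^ m + y * B = 1" if "x * A + y * B = 1" for A B x y :: 'a and m
  proof (induction m)
    case (Suc m)
    then show ?case using step[OF that] by auto
  qed (rule exI[of _ 1], rule exI[of _ 0], simp)
  from pow[OF assms] obtain x y where "x * A ^ m + y * B = 1" by blast
  then have "y * B + x * A ^ m = 1" by (simp add: add.commute)
  from pow[OF this] obtain x y where "x * B ^ n + y * A ^ m = 1" by blast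
  then show ?thesis by (metis add.commute)
qed

text \<open>\<open>(1 + a u) - a (u - a) = 1 + a^2\<close> is nonzero for real \<open>a\<close>, so
  the linear factors are coprime. Reduction modulo \<open>(u - a)^M\<close> bounds \<open>P\<close>
  for every \<open>g\<close>; the bound on \<open>Q\<close> follows by comparing degrees when the
  degree of \<open>g\<close> is below \<open>m + M\<close>.\<close>

lemma partial_fraction:
  fixes a :: real and g :: "complex poly"
  assumes M: "1 \<le> M"
  obtains P Q where "[:1, complex_of_real a:] ^ m * P + [:- complex_of_real a, 1:] ^ M * Q = g"
    "degree P < M" "degree g < m + M \<Longrightarrow> 1 \<le> m \<Longrightarrow> degree Q < m"
proof -
  let ?c = "complex_of_real a"
  let ?A = "[:1, ?c:]" and ?B = "[:- ?c, 1:]"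
  have "0 < 1 + a\<^sup>2" by (simp add: add_pos_nonneg)
  then have "complex_of_real (1 + a\<^sup>2) \<noteq> 0" by (metis less_irrefl of_real_eq_0_iff)
  then have ne: "1 + ?c * ?c \<noteq> 0" by (simp add: power2_eq_square)
  have "[:1 / (1 + ?c * ?c):] * ?A + [:- ?c / (1 + ?c * ?c):] * ?B = 1"
    using ne by (simp add: one_pCons field_simps)
  from bezout_powers[OF this] obtain x y where xy: "x * ?A ^ m + y * ?B ^ M = 1" by blast
  define P where "P = (x * g) mod ?B ^ M"
  define Q where "Q = y * g + ?A ^ m * ((x * g) div ?B ^ M)"
  have degB: "degree (?B ^ M) = M" by (rule degree_linear_power)
  have "?A ^ m * P + ?B ^ M * Q = ?A ^ m * (P + (x * g) div ?B ^ M * ?B ^ M) + y * ?B ^ M * g"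
    unfolding Q_def by (simp add: algebra_simps)
  also have "P + (x * g) div ?B ^ M * ?B ^ M = x * g"
    unfolding P_def by (rule mod_div_mult_eq)
  also have "?A ^ m * (x * g) + y * ?B ^ M * g = (x * ?A ^ m + y * ?B ^ M) * g"
    by (simp add: algebra_simps)
  finally have eq: "?A ^ m * P + ?B ^ M * Q = g" by (simp add: xy)
  have degP: "degree P < M"
    using degree_mod_less[of "?B ^ M" "x * g"] degB M unfolding P_def by auto
  have "degree Q < m" if "degree g < m + M" "1 \<le> m"
  proof (cases "Q = 0")
    case False
    have "degree (?A ^ m * P) \<le> m + degree P"
      using degree_mult_le[of "?A ^ m" P] degree_power_le[of ?A m] by (simp split: if_splits)
    then have "degree (?A ^ m * P) < m + M" using degP by linarith
    moreover have "?B ^ M * Q = g - ?A ^ m * P" using eq by (simp add: algebra_simps)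
    ultimately have "degree (?B ^ M * Q) < m + M"
      using that(1) degree_diff_le_max[of g "?A ^ m * P"] by (simp del: mult_pCons_left)
    moreover have "degree (?B ^ M * Q) = M + degree Q"
      using False degB by (subst degree_mult_eq) auto
    ultimately show ?thesis by simp
  qed (use that in simp)
  then show thesis using that[OF eq degP] by blast
qed

lemma poly_shifted_sum:
  fixes P :: "complex poly"
  assumes "degree P < M"
  obtains c where "\<And>v. poly P v = (\<Sum>i<M. c i * (v - a) ^ i)"
proof
  fix v
  let ?R = "pcompose P [:a, 1:]"
  have "degree ?R < M" using assms by (simp add: degree_pcompose)
  then have "{..degree ?R} \<subseteq> {..<M}" by auto
  have "poly P v = poly ?R (v - a)" by (simp add: poly_pcompose)
  also have "\<dots> = (\<Sum>i<M. coeff ?R i * (v - a) ^ i)"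
    unfolding poly_altdef
    by (rule sum.mono_neutral_left) (use \<open>{..degree ?R} \<subseteq> {..<M}\<close> in \<open>auto simp: coeff_eq_0\<close>)
  finally show "poly P v = (\<Sum>i<M. coeff ?R i * (v - a) ^ i)" .
qed

section \<open>Contour integrals of rational functions with known poles\<close>

context
  fixes \<gamma> :: "real \<Rightarrow> complex"
  assumes path: "valid_path \<gamma>" and loop: "pathfinish \<gamma> = pathstart \<gamma>"
begin

lemma has_contour_integral_inverse_power:
  assumes a: "a \<notin> path_image \<gamma>" and wn: "winding_number \<gamma> a = 1"
  shows "((\<lambda>v. 1 / (v - a) ^ Suc j) has_contour_integral (if j = 0 then 2 * pi * \<i> else 0)) \<gamma>"
proof (cases j)
  case 0
  then show ?thesis using has_contour_integral_winding_number[OF path a] wn by simp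
next
  case (Suc l)
  have "((\<lambda>v. 1 / (v - a) ^ Suc j) has_contour_integral 0) \<gamma>"
  proof (rule Cauchy_theorem_primitive[where S = "- {a}" and f = "\<lambda>v. - 1 / of_nat j * inverse ((v - a) ^ j)"])
    fix v assume "v \<in> - {a}"
    then have ne: "v - a \<noteq> 0" by simp
    define n :: complex where "n = of_nat j"
    have n: "n \<noteq> 0" using Suc unfolding n_def by (simp only: of_nat_eq_0_iff)
    have "((\<lambda>v. (v - a) ^ j) has_field_derivative n * (v - a) ^ l) (at v)"
      unfolding n_def by (auto intro!: derivative_eq_intros simp: Suc simp del: power_Suc)
    from DERIV_cmult[OF DERIV_inverse'[OF this], of "- 1 / n"]
    have "((\<lambda>v. - 1 / n * inverse ((v - a) ^ j)) has_field_derivative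
      - 1 / n * - (inverse ((v - a) ^ j) * (n * (v - a) ^ l) * inverse ((v - a) ^ j))) (at v)"
      using ne by simp
    also have "- 1 / n * - (inverse (w ^ j) * (n * w ^ l) * inverse (w ^ j)) = 1 / w ^ Suc j" if "w \<noteq> 0" for w
      using that n by (simp add: Suc field_simps)
    note this[OF ne]
    finally have "((\<lambda>v. - 1 / n * inverse ((v - a) ^ j)) has_field_derivative 1 / (v - a) ^ Suc j) (at v)" .
    then show "((\<lambda>v. - 1 / of_nat j * inverse ((v - a) ^ j)) has_field_derivative 1 / (v - a) ^ Suc j) (at v within - {a})"
      unfolding n_def by (rule has_field_derivative_at_within)
  qed (use path loop a in auto)
  then show ?thesis using Suc by simp
qed

text \<open>Induction by \<open>1/((v-a)^(j+1) (u-v)) = (1/(v-a)^(j+1) + 1/((v-a)^j (u-v))) /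
  (u-a)\<close>. In the step from \<open>j = 0\<close> the first summand supplies
  \<open>2 * pi * \<i>\<close>; later its integral is zero and the second one carries the value
  on.\<close>

lemma has_contour_integral_inverse_power_cauchy:
  assumes a: "a \<notin> path_image \<gamma>" "winding_number \<gamma> a = 1"
    and u: "u \<notin> path_image \<gamma>" "winding_number \<gamma> u = 0"
  shows "((\<lambda>v. 1 / ((v - a) ^ j * (u - v))) has_contour_integral (if j = 0 then 0 else 2 * pi * \<i> / (u - a) ^ j)) \<gamma>"
proof (induction j)
  case 0
  have "((\<lambda>v. - (1 / (v - u))) has_contour_integral - (2 * pi * \<i> * winding_number \<gamma> u)) \<gamma>"
    by (rule has_contour_integral_neg[OF has_contour_integral_winding_number[OF path u(1)]])
  then have "((\<lambda>v. 1 / (u - v)) has_contour_integral - (2 * pi * \<i> * winding_number \<gamma> u)) \<gamma>"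
    by (rule has_contour_integral_eq) (metis minus_diff_eq minus_divide_right)
  then show ?case using u(2) by simp
next
  case (Suc j)
  have ua: "u - a \<noteq> 0" using a(2) u(2) by auto
  have "((\<lambda>v. (1 / (v - a) ^ Suc j + 1 / ((v - a) ^ j * (u - v))) / (u - a)) has_contour_integral
      ((if j = 0 then 2 * pi * \<i> else 0) + (if j = 0 then 0 else 2 * pi * \<i> / (u - a) ^ j)) / (u - a)) \<gamma>"
    by (intro has_contour_integral_div has_contour_integral_add has_contour_integral_inverse_power[OF a] Suc)
  moreover have "((if j = 0 then 2 * pi * \<i> else 0) + (if j = 0 then 0 else 2 * pi * \<i> / (u - a) ^ j)) / (u - a)
      = 2 * pi * \<i> / (u - a) ^ Suc j"
    by (simp add: mult.commute)
  ultimately have "((\<lambda>v. (1 / (v - a) ^ Suc j + 1 / ((v - a) ^ j * (u - v))) / (u - a)) has_contour_integral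
      2 * pi * \<i> / (u - a) ^ Suc j) \<gamma>" by simp
  then have "((\<lambda>v. 1 / ((v - a) ^ Suc j * (u - v))) has_contour_integral 2 * pi * \<i> / (u - a) ^ Suc j) \<gamma>"
  proof (rule has_contour_integral_eq)
    fix v assume "v \<in> path_image \<gamma>"
    then have va: "v - a \<noteq> 0" and uv: "u - v \<noteq> 0" using a u by auto
    have "1 / x ^ Suc j + 1 / (x ^ j * y) = (y + x) / (x ^ Suc j * y)" if "x \<noteq> 0" "y \<noteq> 0" for x y :: complex
      using that by (simp add: field_simps)
    from this[OF va uv] have "1 / (v - a) ^ Suc j + 1 / ((v - a) ^ j * (u - v))
      = ((u - v) + (v - a)) / ((v - a) ^ Suc j * (u - v))" .
    also have "\<dots> = (u - a) * (1 / ((v - a) ^ Suc j * (u - v)))" by simp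
    finally show "(1 / (v - a) ^ Suc j + 1 / ((v - a) ^ j * (u - v))) / (u - a) = 1 / ((v - a) ^ Suc j * (u - v))"
      using ua by simp
  qed
  then show ?case by simp
qed

text \<open>A proper fraction with its only pole at \<open>a\<close> is a combination of negative
  powers of \<open>v - a\<close>, and Cauchy's formula taken from outside the loop returns its value
  at \<open>u\<close>. A polynomial part would integrate to zero, hence the condition
  \<open>degree P < M\<close>.\<close>

lemma has_contour_integral_polar_part:
  assumes a: "a \<notin> path_image \<gamma>" "winding_number \<gamma> a = 1"
    and u: "u \<notin> path_image \<gamma>" "winding_number \<gamma> u = 0"
    and deg: "degree P < M"
  shows "((\<lambda>v. poly P v / ((v - a) ^ M * (u - v))) has_contour_integral 2 * pi * \<i> * (poly P u / (u - a) ^ M)) \<gamma>"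
proof -
  obtain c where c: "\<And>v. poly P v = (\<Sum>i<M. c i * (v - a) ^ i)"
    using poly_shifted_sum[OF deg] by blast
  have cancel: "c i * (v - a) ^ i / (v - a) ^ M = c i / (v - a) ^ (M - i)" if "i < M" "v - a \<noteq> 0" for i v
    using that by (simp add: power_diff)
  have ua: "u - a \<noteq> 0" using a(2) u(2) by auto
  have "((\<lambda>v. \<Sum>i<M. c i * (1 / ((v - a) ^ (M - i) * (u - v)))) has_contour_integral
      (\<Sum>i<M. c i * (if M - i = 0 then 0 else 2 * pi * \<i> / (u - a) ^ (M - i)))) \<gamma>"
    by (intro has_contour_integral_sum has_contour_integral_lmul
        has_contour_integral_inverse_power_cauchy[OF a u]) simp
  moreover have "(\<Sum>i<M. c i * (if M - i = 0 then 0 else 2 * pi * \<i> / (u - a) ^ (M - i)))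
      = 2 * pi * \<i> * (poly P u / (u - a) ^ M)"
    unfolding c sum_divide_distrib sum_distrib_left
    by (intro sum.cong refl) (use cancel ua in auto)
  ultimately have "((\<lambda>v. \<Sum>i<M. c i * (1 / ((v - a) ^ (M - i) * (u - v)))) has_contour_integral
      2 * pi * \<i> * (poly P u / (u - a) ^ M)) \<gamma>" by simp
  then show ?thesis
  proof (rule has_contour_integral_eq)
    fix v assume "v \<in> path_image \<gamma>"
    then have va: "v - a \<noteq> 0" using a by auto
    have "poly P v / ((v - a) ^ M * (u - v)) = (\<Sum>i<M. c i * (v - a) ^ i / (v - a) ^ M / (u - v))"
      by (simp add: c sum_divide_distrib)
    also have "\<dots> = (\<Sum>i<M. c i * (1 / ((v - a) ^ (M - i) * (u - v))))"
      by (intro sum.cong refl) (use cancel va in auto)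
    finally show "(\<Sum>i<M. c i * (1 / ((v - a) ^ (M - i) * (u - v)))) = poly P v / ((v - a) ^ M * (u - v))" ..
  qed
qed

lemma has_contour_integral_regular_part:
  assumes w: "w \<notin> path_image \<gamma>" "winding_number \<gamma> w = 0"
    and u: "u \<notin> path_image \<gamma>" "winding_number \<gamma> u = 0"
    and c: "\<And>v. 1 + c * v = 0 \<longleftrightarrow> v = w"
  shows "((\<lambda>v. poly Q v / ((1 + c * v) ^ m * (u - v))) has_contour_integral 0) \<gamma>"
proof (rule Cauchy_theorem_global[where S = "- {w, u}"])
  show "(\<lambda>v. poly Q v / ((1 + c * v) ^ m * (u - v))) holomorphic_on - {w, u}"
    using c by (intro holomorphic_intros) auto
qed (use path loop w u in auto)

lemma has_contour_integral_coeff: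
  assumes "0 \<notin> path_image \<gamma>" "winding_number \<gamma> 0 = 1"
  shows "((\<lambda>u. poly R u / u ^ Suc L) has_contour_integral 2 * pi * \<i> * coeff R L) \<gamma>"
proof -
  have mono: "((\<lambda>u. u ^ i / u ^ Suc L) has_contour_integral (if i = L then 2 * pi * \<i> else 0)) \<gamma>" for i
  proof (cases "i \<le> L")
    case True
    have "((\<lambda>u. 1 / (u - 0) ^ Suc (L - i)) has_contour_integral (if L - i = 0 then 2 * pi * \<i> else 0)) \<gamma>"
      using assms by (rule has_contour_integral_inverse_power)
    then have "((\<lambda>u. u ^ i / u ^ Suc L) has_contour_integral (if L - i = 0 then 2 * pi * \<i> else 0)) \<gamma>"
    proof (rule has_contour_integral_eq)
      fix u assume "u \<in> path_image \<gamma>"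
      then have "u \<noteq> 0" using assms by auto
      moreover have "Suc L = i + Suc (L - i)" using True by simp
      ultimately show "1 / (u - 0) ^ Suc (L - i) = u ^ i / u ^ Suc L"
        by (simp only: power_add) simp
    qed
    moreover have "L - i = 0 \<longleftrightarrow> i = L" using True by auto
    ultimately show ?thesis by (simp only:)
  next
    case False
    have "((\<lambda>u. u ^ (i - Suc L)) has_contour_integral 0) \<gamma>"
      by (rule Cauchy_theorem_global[where S = UNIV]) (use path loop in \<open>auto intro!: holomorphic_intros\<close>)
    then have "((\<lambda>u. u ^ i / u ^ Suc L) has_contour_integral 0) \<gamma>"
    proof (rule has_contour_integral_eq)
      fix u assume "u \<in> path_image \<gamma>"
      then have "u \<noteq> 0" using assms by auto
      then show "u ^ (i - Suc L) = u ^ i / u ^ Suc L" using False by (simp add: power_diff del: power_Suc)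
    qed
    then show ?thesis using False by simp
  qed
  have "((\<lambda>u. \<Sum>i\<le>degree R. coeff R i * (u ^ i / u ^ Suc L)) has_contour_integral
      (\<Sum>i\<le>degree R. coeff R i * (if i = L then 2 * pi * \<i> else 0))) \<gamma>"
    by (intro has_contour_integral_sum has_contour_integral_lmul mono) simp
  moreover have "(\<Sum>i\<le>degree R. coeff R i * (if i = L then 2 * pi * \<i> else 0)) = 2 * pi * \<i> * coeff R L"
  proof -
    have "(\<Sum>i\<le>degree R. coeff R i * (if i = L then 2 * pi * \<i> else 0))
      = (\<Sum>i\<le>degree R. if i = L then 2 * pi * \<i> * coeff R L else 0)"
      by (intro sum.cong refl) simp
    also have "\<dots> = 2 * pi * \<i> * coeff R L" by (auto simp: coeff_eq_0)
    finally show ?thesis .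
  qed
  moreover have "(\<lambda>u. \<Sum>i\<le>degree R. coeff R i * (u ^ i / u ^ Suc L)) = (\<lambda>u. poly R u / u ^ Suc L)"
    by (simp add: poly_altdef sum_divide_distrib)
  ultimately show ?thesis by (simp del: power_Suc)
qed

end

text \<open>Of \<open>v^n' W(v) = P/(v-a)^(N-m+1) + Q/(1+a v)^m\<close> the inner contour retains
  the first summand, evaluated at \<open>u\<close>. Division by \<open>W(u)\<close> cancels its
  denominator and leaves a Laurent polynomial in \<open>u\<close>, so the outer integral sees only
  the pole at 0, wherever \<open>-1/a\<close> lies relative to
  \<open>\<Sigma>\<^sub>2\<close>.\<close>

lemma K_aztec_eq_coeff:
  fixes a :: real and P Q :: "complex poly"
  assumes a: "0 < a"
    and \<Sigma>1: "positive_contour \<Sigma>\<^sub>1" "complex_of_real a \<in> inside (path_image \<Sigma>\<^sub>1)"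
      "- 1 / complex_of_real a \<in> outside (path_image \<Sigma>\<^sub>1)"
    and \<Sigma>2: "positive_contour \<Sigma>\<^sub>2" "path_image \<Sigma>\<^sub>1 \<subseteq> inside (path_image \<Sigma>\<^sub>2)"
      "0 \<in> inside (path_image \<Sigma>\<^sub>2)"
    and PQ: "[:1, complex_of_real a:] ^ m * P + [:- complex_of_real a, 1:] ^ (N - m + 1) * Q
      = monom 1 (N - m + n')"
    and deg: "degree P < N - m + 1"
  shows "K_aztec a N m \<Sigma>\<^sub>1 \<Sigma>\<^sub>2 (int n) (int n') = coeff ([:1, complex_of_real a:] ^ m * P) (N - m + n)"
proof -
  let ?c = "complex_of_real a" and ?M = "N - m + 1"
  let ?w = "- 1 / ?c"
  have c0: "?c \<noteq> 0" using a by simp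
  have root: "1 + ?c * v = 0 \<longleftrightarrow> v = ?w" for v
    using c0 by (auto simp: field_simps add_eq_0_iff)
  from \<Sigma>1(1) have s1: "valid_path \<Sigma>\<^sub>1" "pathfinish \<Sigma>\<^sub>1 = pathstart \<Sigma>\<^sub>1"
    "\<And>z. z \<in> inside (path_image \<Sigma>\<^sub>1) \<Longrightarrow> winding_number \<Sigma>\<^sub>1 z = 1"
    by (auto simp: positive_contour_def)
  from \<Sigma>2(1) have s2: "valid_path \<Sigma>\<^sub>2" "pathfinish \<Sigma>\<^sub>2 = pathstart \<Sigma>\<^sub>2"
    "\<And>z. z \<in> inside (path_image \<Sigma>\<^sub>2) \<Longrightarrow> winding_number \<Sigma>\<^sub>2 z = 1"
    by (auto simp: positive_contour_def)
  \<comment> \<open>Nested insides place every point of \<open>\<Sigma>\<^sub>2\<close> outside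
    \<open>\<Sigma>\<^sub>1\<close>, where the winding number vanishes.\<close>
  have ins: "inside (path_image \<Sigma>\<^sub>1) \<subseteq> inside (path_image \<Sigma>\<^sub>2)"
    using \<Sigma>2(2) s1(1) s2(1)
    by (intro inside_inside_compact_connected)
      (auto simp: compact_valid_path_image connected_valid_path_image compact_imp_closed)
  have notin: "z \<notin> path_image g" if "z \<in> inside (path_image g)" for z and g :: "real \<Rightarrow> complex"
    using that inside_no_overlap by blast
  have wa: "?c \<notin> path_image \<Sigma>\<^sub>1" "winding_number \<Sigma>\<^sub>1 ?c = 1"
    using \<Sigma>1(2) s1(3) notin by auto
  have ww: "?w \<notin> path_image \<Sigma>\<^sub>1" "winding_number \<Sigma>\<^sub>1 ?w = 0"
    using \<Sigma>1(3) outside_no_overlap winding_number_zero_in_outside[OF valid_path_imp_path[OF s1(1)] s1(2)]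
    by blast+
  have w0: "0 \<notin> path_image \<Sigma>\<^sub>2" "winding_number \<Sigma>\<^sub>2 0 = 1"
    using \<Sigma>2(3) s2(3) notin by auto
  have polyPQ: "(1 + ?c * v) ^ m * poly P v + (v - ?c) ^ ?M * poly Q v = v ^ (N - m + n')" for v
    using arg_cong[OF PQ, of "\<lambda>p. poly p v"] by (simp add: poly_monom algebra_simps)
  have inner: "contour_integral \<Sigma>\<^sub>1 (\<lambda>v. (u powi (- int n - 1) * v powi int n') / (u - v) * (W a N m v / W a N m u))
      = 2 * pi * \<i> * (poly ([:1, ?c:] ^ m * P) u / u ^ Suc (N - m + n))"
    if u: "u \<in> path_image \<Sigma>\<^sub>2" for u
  proof -
    have "u \<notin> inside (path_image \<Sigma>\<^sub>2)" using u notin by blast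
    then have "u \<notin> inside (path_image \<Sigma>\<^sub>1)" and u1: "u \<notin> path_image \<Sigma>\<^sub>1" using ins \<Sigma>2(2) by auto
    then have "u \<in> outside (path_image \<Sigma>\<^sub>1)" using inside_Un_outside[of "path_image \<Sigma>\<^sub>1"] by blast
    then have u2: "winding_number \<Sigma>\<^sub>1 u = 0"
      by (rule winding_number_zero_in_outside[OF valid_path_imp_path[OF s1(1)] s1(2)])
    have u0: "u \<noteq> 0" using u w0 by auto
    have uc: "u - ?c \<noteq> 0" using u2 wa(2) by auto
    define C where "C = u powi (- int n - 1) / W a N m u"
    have "((\<lambda>v. C * (poly P v / ((v - ?c) ^ ?M * (u - v)) + poly Q v / ((1 + ?c * v) ^ m * (u - v))))
        has_contour_integral C * (2 * pi * \<i> * (poly P u / (u - ?c) ^ ?M) + 0)) \<Sigma>\<^sub>1"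
      by (intro has_contour_integral_lmul has_contour_integral_add
          has_contour_integral_polar_part[OF s1(1,2) wa u1 u2 deg]
          has_contour_integral_regular_part[OF s1(1,2) ww u1 u2 root])
    then have "((\<lambda>v. (u powi (- int n - 1) * v powi int n') / (u - v) * (W a N m v / W a N m u))
        has_contour_integral C * (2 * pi * \<i> * (poly P u / (u - ?c) ^ ?M) + 0)) \<Sigma>\<^sub>1"
    proof (rule has_contour_integral_eq)
      fix v assume v: "v \<in> path_image \<Sigma>\<^sub>1"
      have vc: "v - ?c \<noteq> 0" using v wa by auto
      have vw: "1 + ?c * v \<noteq> 0" using v ww root by auto
      have "v ^ n' * W a N m v = v ^ (N - m + n') / ((v - ?c) ^ ?M * (1 + ?c * v) ^ m)"
        unfolding W_def by (simp add: power_add mult.commute)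
      also have "\<dots> = poly P v / (v - ?c) ^ ?M + poly Q v / (1 + ?c * v) ^ m"
        unfolding polyPQ[symmetric] using vc vw by (simp add: add_divide_distrib)
      finally have *: "v ^ n' * W a N m v = poly P v / (v - ?c) ^ ?M + poly Q v / (1 + ?c * v) ^ m" .
      have "(u powi (- int n - 1) * v powi int n') / (u - v) * (W a N m v / W a N m u)
          = C * ((v ^ n' * W a N m v) / (u - v))"
        by (simp add: C_def mult_ac)
      also have "\<dots> = C * (poly P v / ((v - ?c) ^ ?M * (u - v)) + poly Q v / ((1 + ?c * v) ^ m * (u - v)))"
        unfolding * by (simp add: add_divide_distrib)
      finally show "C * (poly P v / ((v - ?c) ^ ?M * (u - v)) + poly Q v / ((1 + ?c * v) ^ m * (u - v)))
          = (u powi (- int n - 1) * v powi int n') / (u - v) * (W a N m v / W a N m u)" ..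
    qed
    then have "contour_integral \<Sigma>\<^sub>1 (\<lambda>v. (u powi (- int n - 1) * v powi int n') / (u - v) * (W a N m v / W a N m u))
        = C * (2 * pi * \<i> * (poly P u / (u - ?c) ^ ?M) + 0)"
      by (rule contour_integral_unique)
    also have "\<dots> = 2 * pi * \<i> * (C * (poly P u / (u - ?c) ^ ?M))" by simp
    also have "C * (poly P u / (u - ?c) ^ ?M) = poly ([:1, ?c:] ^ m * P) u / u ^ Suc (N - m + n)"
    proof -
      have "u powi (- int n - 1) = 1 / u ^ Suc n"
      proof -
        have "- int n - 1 = - int (Suc n)" by simp
        then show ?thesis
          by (simp only: power_int_minus power_int_of_nat inverse_eq_divide)
      qed
      \<comment> \<open>This also holds if \<open>\<Sigma>\<^sub>2\<close> passes through
        \<open>-1/a\<close>: if \<open>m > 0\<close>, then \<open>W\<close> is there a division by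
        zero with value 0, so \<open>C\<close> is 0, as is the right-hand side.\<close>
      then have "C = (u - ?c) ^ ?M * (1 + ?c * u) ^ m / (u ^ (N - m) * u ^ Suc n)"
        by (simp add: C_def W_def mult.commute)
      moreover have "u ^ (N - m) * u ^ Suc n = u ^ Suc (N - m + n)" by (simp add: power_add)
      ultimately have "C = (u - ?c) ^ ?M * (1 + ?c * u) ^ m / u ^ Suc (N - m + n)" by simp
      then have "C * (poly P u / (u - ?c) ^ ?M) = (1 + ?c * u) ^ m * poly P u / u ^ Suc (N - m + n)"
        using uc by simp
      then show ?thesis by (simp add: mult.commute)
    qed
    finally show ?thesis .
  qed
  have "contour_integral \<Sigma>\<^sub>2 (\<lambda>u. contour_integral \<Sigma>\<^sub>1
       (\<lambda>v. (u powi (- int n - 1) * v powi int n') / (u - v) * (W a N m v / W a N m u)))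
     = contour_integral \<Sigma>\<^sub>2 (\<lambda>u. 2 * pi * \<i> * (poly ([:1, ?c:] ^ m * P) u / u ^ Suc (N - m + n)))"
    using inner by (rule contour_integral_eq)
  also have "\<dots> = 2 * pi * \<i> * (2 * pi * \<i> * coeff ([:1, ?c:] ^ m * P) (N - m + n))"
    by (intro contour_integral_unique has_contour_integral_lmul has_contour_integral_coeff[OF s2(1,2) w0])
  also have "\<dots> = (2 * pi * \<i>) ^ 2 * coeff ([:1, ?c:] ^ m * P) (N - m + n)"
    by (simp only: power2_eq_square mult.assoc)
  finally show ?thesis unfolding K_aztec_def by simp
qed

section \<open>Fredholm determinants of kernels with finite support\<close>

text \<open>A Leibniz determinant over an unordered index set, so that principal minors can be
  summed over subsets.\<close>

definition set_det :: "('b \<Rightarrow> 'b \<Rightarrow> 'a :: comm_ring_1) \<Rightarrow> 'b set \<Rightarrow> 'a" where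
  "set_det A S = (\<Sum>\<sigma> | \<sigma> permutes S. of_int (sign \<sigma>) * (\<Prod>s\<in>S. A s (\<sigma> s)))"

text \<open>Relabelling rows and columns by one bijection conjugates the permutations and keeps
  their signs; in particular a principal minor does not depend on the order of its indices.\<close>

lemma det_eq_set_det:
  assumes inj: "inj_on f {0..<p}"
  shows "det (mat p p (\<lambda>(i, j). A (f i) (f j))) = set_det A (f ` {0..<p})"
proof -
  let ?I = "{0..<p}" and ?B = "f ` {0..<p}"
  have bij: "bij_betw f ?I ?B" using inj by (simp add: bij_betw_def)
  define g where "g = inv_into ?I f"
  have gf: "g (f i) = i" if "i \<in> ?I" for i using inj that by (simp add: g_def)
  have fg: "f (g x) = x" "g x \<in> ?I" if "x \<in> ?B" for x
    using that f_inv_into_f[of x f ?I] inv_into_into[of x f ?I] by (simp_all only: g_def)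
  have bij': "bij_betw g ?B ?I" using bij unfolding g_def by (rule bij_betw_inv_into)
  have mp: "map_permutation ?I f \<pi> (f i) = f (\<pi> i)" if "i \<in> ?I" for \<pi> i
    using that gf by (auto simp: map_permutation_def restrict_id_def g_def)
  have "set_det A ?B = (\<Sum>\<pi> | \<pi> permutes ?I. of_int (sign \<pi>) * (\<Prod>i\<in>?I. A (f i) (f (\<pi> i))))"
    unfolding set_det_def
  proof (rule sum.reindex_bij_witness[where i = "map_permutation ?I f" and j = "map_permutation ?B g"])
    fix \<sigma> assume "\<sigma> \<in> {\<sigma>. \<sigma> permutes ?B}"
    then have \<sigma>: "\<sigma> permutes ?B" by simp
    then show p: "map_permutation ?B g \<sigma> \<in> {\<pi>. \<pi> permutes ?I}"
      using map_permutation_permutes[OF bij'] by simp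
    have "map_permutation ?I f (map_permutation ?B g \<sigma>) = map_permutation ?B (f \<circ> g) \<sigma>"
      by (rule map_permutation_compose[OF bij']) (simp add: inj)
    also have "\<dots> = map_permutation ?B id \<sigma>"
      by (rule map_permutation_cong) (use \<sigma> fg in \<open>auto simp: inj_on_def\<close>)
    finally show eq: "map_permutation ?I f (map_permutation ?B g \<sigma>) = \<sigma>" using \<sigma> by simp
    have "sign \<sigma> = sign (map_permutation ?B g \<sigma>)"
      using sign_map_permutation[of g ?B \<sigma>] \<sigma> bij' by (simp add: bij_betw_def)
    moreover have "(\<Prod>s\<in>?B. A s (\<sigma> s)) = (\<Prod>i\<in>?I. A (f i) (\<sigma> (f i)))"
      using inj by (simp add: prod.reindex)
    moreover have "\<sigma> (f i) = f (map_permutation ?B g \<sigma> i)" if "i \<in> ?I" for i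
      using mp[OF that, of "map_permutation ?B g \<sigma>"] eq by simp
    ultimately show "of_int (sign (map_permutation ?B g \<sigma>)) * (\<Prod>i\<in>?I. A (f i) (f (map_permutation ?B g \<sigma> i)))
        = of_int (sign \<sigma>) * (\<Prod>s\<in>?B. A s (\<sigma> s))" by simp
  next
    fix \<pi> assume "\<pi> \<in> {\<pi>. \<pi> permutes ?I}"
    then have \<pi>: "\<pi> permutes ?I" by simp
    then show "map_permutation ?I f \<pi> \<in> {\<sigma>. \<sigma> permutes ?B}"
      using map_permutation_permutes[OF bij] by simp
    have "map_permutation ?B g (map_permutation ?I f \<pi>) = map_permutation ?I (g \<circ> f) \<pi>"
      by (rule map_permutation_compose[OF bij]) (use bij' in \<open>simp add: bij_betw_def\<close>)
    also have "\<dots> = map_permutation ?I id \<pi>"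
      by (rule map_permutation_cong) (use \<pi> gf in \<open>auto simp: inj_on_def\<close>)
    finally show "map_permutation ?B g (map_permutation ?I f \<pi>) = \<pi>" using \<pi> by simp
  qed
  also have "\<dots> = det (mat p p (\<lambda>(i, j). A (f i) (f j)))"
  proof (subst det_def'[of _ p], simp, rule sum.cong[OF refl])
    fix \<pi> assume "\<pi> \<in> {\<pi>. \<pi> permutes ?I}"
    then have "\<pi> i < p" if "i < p" for i
      using that permutes_in_image[of \<pi> ?I i] by simp
    then show "of_int (sign \<pi>) * (\<Prod>i\<in>?I. A (f i) (f (\<pi> i)))
        = of_int (sign \<pi>) * (\<Prod>i\<in>?I. mat p p (\<lambda>(i, j). A (f i) (f j)) $$ (i, \<pi> i))"
      by (intro arg_cong2[of _ _ _ _ "(*)"] refl prod.cong) auto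
  qed
  finally show ?thesis ..
qed

text \<open>The Leibniz products are multiplied out, \<open>T\<close> being the set of places where
  \<open>- A\<close> is chosen; the Kronecker deltas at the other places leave only the permutations
  of \<open>T\<close>.\<close>

lemma set_det_id_minus:
  assumes fin: "finite S"
  shows "set_det (\<lambda>x y. (if x = y then 1 else 0) - A x y) S = (\<Sum>T\<in>Pow S. (-1) ^ card T * set_det A T)"
proof -
  let ?\<delta> = "\<lambda>x y. if x = y then 1 else (0 :: 'b)"
  have expand: "(\<Prod>s\<in>S. ?\<delta> s (\<sigma> s) - A s (\<sigma> s))
      = (\<Sum>T\<in>Pow S. if \<forall>s\<in>S - T. \<sigma> s = s then (-1) ^ card T * (\<Prod>s\<in>T. A s (\<sigma> s)) else 0)" for \<sigma>
  proof -
    have "(\<Prod>s\<in>S. ?\<delta> s (\<sigma> s) - A s (\<sigma> s)) = (\<Prod>s\<in>S. (- 1) * A s (\<sigma> s) + ?\<delta> s (\<sigma> s))"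
      by (rule prod.cong[OF refl]) simp
    also have "\<dots> = (\<Sum>T\<in>Pow S. (\<Prod>s\<in>T. (- 1) * A s (\<sigma> s)) * (\<Prod>s\<in>S - T. ?\<delta> s (\<sigma> s)))"
      by (rule prod_add[OF fin])
    also have "\<dots> = (\<Sum>T\<in>Pow S. if \<forall>s\<in>S - T. \<sigma> s = s then (-1) ^ card T * (\<Prod>s\<in>T. A s (\<sigma> s)) else 0)"
    proof (rule sum.cong[OF refl])
      fix T
      have "(\<Prod>s\<in>S - T. ?\<delta> s (\<sigma> s)) = (if \<forall>s\<in>S - T. \<sigma> s = s then 1 else 0)"
      proof (cases "\<forall>s\<in>S - T. \<sigma> s = s")
        case True
        then show ?thesis by (intro trans[OF prod.neutral]) auto
      next
        case False
        then obtain s where "s \<in> S - T" "s \<noteq> \<sigma> s" by metis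
        then have "(\<Prod>s\<in>S - T. ?\<delta> s (\<sigma> s)) = 0"
          using fin by (intro prod_zero) auto
        then show ?thesis by (simp only: False if_False)
      qed
      then show "(\<Prod>s\<in>T. (- 1) * A s (\<sigma> s)) * (\<Prod>s\<in>S - T. ?\<delta> s (\<sigma> s))
          = (if \<forall>s\<in>S - T. \<sigma> s = s then (-1) ^ card T * (\<Prod>s\<in>T. A s (\<sigma> s)) else 0)"
        by (simp add: prod.distrib del: mult_minus_left mult_minus1)
    qed
    finally show ?thesis .
  qed
  have finP: "finite {\<sigma>. \<sigma> permutes S}" using fin by (rule finite_permutations)
  have "set_det (\<lambda>x y. ?\<delta> x y - A x y) S = (\<Sum>\<sigma> | \<sigma> permutes S. \<Sum>T\<in>Pow S.
      if \<forall>s\<in>S - T. \<sigma> s = s then of_int (sign \<sigma>) * ((-1) ^ card T * (\<Prod>s\<in>T. A s (\<sigma> s))) else 0)"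
    unfolding set_det_def expand sum_distrib_left by (intro sum.cong refl) simp
  also have "\<dots> = (\<Sum>T\<in>Pow S. \<Sum>\<sigma> | \<sigma> permutes S.
      if \<forall>s\<in>S - T. \<sigma> s = s then of_int (sign \<sigma>) * ((-1) ^ card T * (\<Prod>s\<in>T. A s (\<sigma> s))) else 0)"
    by (rule sum.swap)
  also have "\<dots> = (\<Sum>T\<in>Pow S. (-1) ^ card T * set_det A T)"
  proof (rule sum.cong[OF refl])
    fix T assume T: "T \<in> Pow S"
    have "{\<sigma>. \<sigma> permutes S} \<inter> {\<sigma>. \<forall>s\<in>S - T. \<sigma> s = s} = {\<sigma>. \<sigma> permutes T}"
      using T by (auto intro: permutes_superset permutes_subset dest: permutes_not_in)
    then have "(\<Sum>\<sigma> | \<sigma> permutes S.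
      if \<forall>s\<in>S - T. \<sigma> s = s then of_int (sign \<sigma>) * ((-1) ^ card T * (\<Prod>s\<in>T. A s (\<sigma> s))) else 0)
      = (\<Sum>\<sigma> | \<sigma> permutes T. of_int (sign \<sigma>) * ((-1) ^ card T * (\<Prod>s\<in>T. A s (\<sigma> s))))"
      using finP by (simp add: sum.If_cases)
    also have "\<dots> = (-1) ^ card T * set_det A T"
      unfolding set_det_def sum_distrib_left by (simp add: mult.left_commute)
    finally show "(\<Sum>\<sigma> | \<sigma> permutes S.
      if \<forall>s\<in>S - T. \<sigma> s = s then of_int (sign \<sigma>) * ((-1) ^ card T * (\<Prod>s\<in>T. A s (\<sigma> s))) else 0)
      = (-1) ^ card T * set_det A T" .
  qed
  finally show ?thesis .
qed

text \<open>These enumerations of a set cancel the factorial in the Fredholm series.\<close>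

lemma card_bij_betw_funcset:
  assumes "finite T" "card T = p"
  shows "card {f \<in> {0..<p} \<rightarrow>\<^sub>E T. bij_betw f {0..<p} T} = fact p"
proof -
  have "{f \<in> {0..<p} \<rightarrow>\<^sub>E T. bij_betw f {0..<p} T} = {f \<in> {0..<p} \<rightarrow>\<^sub>E T. inj_on f {0..<p}}"
  proof (rule Collect_cong)
    fix f
    have "f ` {0..<p} = T" if "f \<in> {0..<p} \<rightarrow>\<^sub>E T" "inj_on f {0..<p}"
      using that assms by (intro card_subset_eq) (auto simp: card_image)
    then show "f \<in> {0..<p} \<rightarrow>\<^sub>E T \<and> bij_betw f {0..<p} T \<longleftrightarrow> f \<in> {0..<p} \<rightarrow>\<^sub>E T \<and> inj_on f {0..<p}"
      by (auto simp: bij_betw_def)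
  qed
  moreover have "card {f \<in> {0..<p} \<rightarrow>\<^sub>E T. inj_on f {0..<p}} = prod ((-) p) {0..<p}"
    using card_inj_on_subset_funcset[of "{0..<p}" T "{0..<p}"] assms by simp
  ultimately show ?thesis
    by (simp add: fact_prod_rev)
qed

lemma fredholm_minor_eq_0:
  assumes "\<exists>i<p. \<forall>j<p. K (ns i) (ns j) = 0"
  shows "fredholm_minor K p ns = 0"
proof -
  obtain i where i: "i < p" "\<And>j. j < p \<Longrightarrow> K (ns i) (ns j) = 0" using assms by blast
  have "(\<Prod>l<p. K (ns l) (ns (\<pi> l))) = 0" if "\<pi> permutes {0..<p}" for \<pi>
    using i permutes_in_image[OF that, of i] by (intro prod_zero) auto
  then show ?thesis
    unfolding fredholm_minor_def
    by (subst det_def'[of _ p]) (auto intro!: sum.neutral simp: atLeast0LessThan permutes_in_image[of _ "{..<p}"] lessThan_iff[symmetric] simp del: lessThan_iff cong: prod.cong)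
qed

section \<open>The Fredholm series of a kernel whose rows vanish beyond \<open>l\<close>\<close>

context
  fixes K :: "int \<Rightarrow> int \<Rightarrow> complex" and k l :: int
  assumes zero: "\<And>n n'. l < n \<Longrightarrow> k \<le> n' \<Longrightarrow> K n n' = 0"
begin

text \<open>An index beyond \<open>l\<close> produces a zero row, a repeated index two equal
  rows.\<close>

lemma fredholm_minor_support:
  assumes "ns \<in> {0..<p} \<rightarrow>\<^sub>E {k..}" "fredholm_minor K p ns \<noteq> 0"
  shows "ns \<in> {0..<p} \<rightarrow>\<^sub>E {k..l}" "inj_on ns {0..<p}"
proof -
  have k: "k \<le> ns i" if "i < p" for i using assms(1) that by auto
  have "ns i \<le> l" if "i < p" for i
    using fredholm_minor_eq_0[of p K ns] assms(2) zero[of "ns i"] k that by force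
  then show "ns \<in> {0..<p} \<rightarrow>\<^sub>E {k..l}" using assms(1) k by (auto simp: PiE_def Pi_def)
  show "inj_on ns {0..<p}"
  proof (rule inj_onI, rule ccontr)
    fix i j assume "i \<in> {0..<p}" "j \<in> {0..<p}" "ns i = ns j" "i \<noteq> j"
    then have "det (mat p p (\<lambda>(i, j). K (ns i) (ns j))) = 0"
      by (intro det_identical_rows[of _ p i j]) (auto intro!: eq_vecI)
    then show False using assms(2) by (simp add: fredholm_minor_def)
  qed
qed

lemma fredholm_minor_summable: "fredholm_minor K p summable_on ({0..<p} \<rightarrow>\<^sub>E {k..})"
  and fredholm_minor_infsum: "(\<Sum>\<^sub>\<infinity>ns\<in>{0..<p} \<rightarrow>\<^sub>E {k..}. fredholm_minor K p ns)
    = fact p * (\<Sum>T | T \<subseteq> {k..l} \<and> card T = p. set_det K T)"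
proof -
  let ?F = "{ns \<in> {0..<p} \<rightarrow>\<^sub>E {k..l}. inj_on ns {0..<p}}"
  let ?B = "\<lambda>T. {f \<in> {0..<p} \<rightarrow>\<^sub>E T. bij_betw f {0..<p} T}"
  have fin: "finite ?F" by (simp add: finite_PiE)
  have sub: "?F \<subseteq> {0..<p} \<rightarrow>\<^sub>E {k..}" by (auto simp: PiE_def Pi_def)
  show "fredholm_minor K p summable_on ({0..<p} \<rightarrow>\<^sub>E {k..})"
    using summable_on_finite[OF fin, of "fredholm_minor K p"]
    by (rule summable_on_cong_neutral[THEN iffD1, rotated 3])
      (use fredholm_minor_support sub in blast)+
  have "(\<Sum>\<^sub>\<infinity>ns\<in>{0..<p} \<rightarrow>\<^sub>E {k..}. fredholm_minor K p ns) = infsum (fredholm_minor K p) ?F"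
    by (rule infsum_cong_neutral) (use fredholm_minor_support sub in blast)+
  also have "\<dots> = (\<Sum>ns\<in>?F. fredholm_minor K p ns)" using fin by simp
  \<comment> \<open>Injective tuples are grouped by their range; all orderings of one range have the
    same minor.\<close>
  also have "?F = (\<Union>T\<in>{T. T \<subseteq> {k..l} \<and> card T = p}. ?B T)"
  proof (intro equalityI subsetI)
    fix f assume f: "f \<in> ?F"
    then have "f ` {0..<p} \<subseteq> {k..l}" "card (f ` {0..<p}) = p" by (auto simp: card_image)
    moreover have "f \<in> ?B (f ` {0..<p})" using f by (auto simp: bij_betw_def PiE_def)
    ultimately show "f \<in> (\<Union>T\<in>{T. T \<subseteq> {k..l} \<and> card T = p}. ?B T)" by blast
  next
    fix f assume "f \<in> (\<Union>T\<in>{T. T \<subseteq> {k..l} \<and> card T = p}. ?B T)"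
    then obtain T where "T \<subseteq> {k..l}" "f \<in> {0..<p} \<rightarrow>\<^sub>E T" "bij_betw f {0..<p} T" by blast
    then show "f \<in> ?F"
      using PiE_mono[of "{0..<p}" "\<lambda>_. T" "\<lambda>_. {k..l}"] by (auto simp: bij_betw_def)
  qed
  also have "(\<Sum>ns\<in>(\<Union>T\<in>{T. T \<subseteq> {k..l} \<and> card T = p}. ?B T). fredholm_minor K p ns)
      = (\<Sum>T | T \<subseteq> {k..l} \<and> card T = p. \<Sum>ns\<in>?B T. fredholm_minor K p ns)"
  proof (rule sum.UNION_disjoint)
    show "\<forall>T\<in>{T. T \<subseteq> {k..l} \<and> card T = p}. finite (?B T)"
    proof
      fix T assume "T \<in> {T. T \<subseteq> {k..l} \<and> card T = p}"
      then have "finite T" by (auto dest: finite_subset[OF _ finite_atLeastAtMost_int])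
      then have "finite ({0..<p} \<rightarrow>\<^sub>E T)" by (simp add: finite_PiE)
      then show "finite (?B T)" by (rule rev_finite_subset) blast
    qed
    show "\<forall>T\<in>{T. T \<subseteq> {k..l} \<and> card T = p}. \<forall>T'\<in>{T. T \<subseteq> {k..l} \<and> card T = p}.
        T \<noteq> T' \<longrightarrow> ?B T \<inter> ?B T' = {}"
      by (auto simp: bij_betw_def)
  qed (simp add: finite_subset[of _ "Pow {k..l}"] subset_iff)
  also have "\<dots> = (\<Sum>T | T \<subseteq> {k..l} \<and> card T = p. fact p * set_det K T)"
  proof (rule sum.cong[OF refl])
    fix T assume "T \<in> {T. T \<subseteq> {k..l} \<and> card T = p}"
    then have T: "finite T" "card T = p" by (auto dest: finite_subset[OF _ finite_atLeastAtMost_int])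
    have "fredholm_minor K p ns = set_det K T" if "ns \<in> ?B T" for ns
      using that det_eq_set_det[of ns p K] by (auto simp: fredholm_minor_def bij_betw_def)
    then have "(\<Sum>ns\<in>?B T. fredholm_minor K p ns) = (\<Sum>ns\<in>?B T. set_det K T)"
      by (rule sum.cong[OF refl])
    also have "\<dots> = fact p * set_det K T"
      by (simp add: card_bij_betw_funcset[OF T])
    finally show "(\<Sum>ns\<in>?B T. fredholm_minor K p ns) = fact p * set_det K T" .
  qed
  finally show "(\<Sum>\<^sub>\<infinity>ns\<in>{0..<p} \<rightarrow>\<^sub>E {k..}. fredholm_minor K p ns)
      = fact p * (\<Sum>T | T \<subseteq> {k..l} \<and> card T = p. set_det K T)"
    by (simp add: sum_distrib_left)
qed

lemma fredholm_term_eq: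
  "fredholm_term K k p = (\<Sum>T | T \<subseteq> {k..l} \<and> card T = p. (-1) ^ card T * set_det K T)"
proof -
  have "fredholm_term K k p = (-1) ^ p * (\<Sum>T | T \<subseteq> {k..l} \<and> card T = p. set_det K T)"
    unfolding fredholm_term_def fredholm_minor_infsum by simp
  also have "\<dots> = (\<Sum>T | T \<subseteq> {k..l} \<and> card T = p. (-1) ^ card T * set_det K T)"
    unfolding sum_distrib_left by (intro sum.cong refl) auto
  finally show ?thesis .
qed

lemma fredholm_term_eq_0: "fredholm_term K k p = 0" if "card {k..l} < p"
proof -
  have "card T < p" if "T \<subseteq> {k..l}" for T
    using card_mono[OF finite_atLeastAtMost_int that] \<open>card {k..l} < p\<close> by simp
  then have empty: "{T. T \<subseteq> {k..l} \<and> card T = p} = {}" by auto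
  show ?thesis unfolding fredholm_term_eq empty by simp
qed

lemma fredholm_convergent_finite: "fredholm_convergent K k"
proof -
  have "summable (\<lambda>q. fredholm_term K k (Suc q))"
    by (rule summable_finite[of "{..card {k..l}}"]) (auto intro: fredholm_term_eq_0)
  then show ?thesis by (simp add: fredholm_convergent_def fredholm_minor_summable)
qed

lemma fredholm_det_finite:
  "fredholm_det K k = set_det (\<lambda>x y. (if x = y then 1 else 0) - K x y) {k..l}"
proof -
  let ?c = "card {k..l}"
  \<comment> \<open>The leading 1 of the Fredholm series is its term at \<open>p = 0\<close>,
    contributed by the empty set in the expansion over subsets.\<close>
  have term0: "fredholm_term K k 0 = 1"
  proof -
    have "{T. T \<subseteq> {k..l} \<and> card T = 0} = {{}}"
      by (auto dest: finite_subset[OF _ finite_atLeastAtMost_int])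
    moreover have "{\<sigma> :: int \<Rightarrow> int. \<sigma> permutes {}} = {id}" by auto
    ultimately show ?thesis by (simp add: fredholm_term_eq set_det_def)
  qed
  have "(\<Sum>q. fredholm_term K k (Suc q)) = (\<Sum>q<?c. fredholm_term K k (Suc q))"
    by (rule suminf_finite) (auto intro: fredholm_term_eq_0)
  then have "fredholm_det K k = (\<Sum>p\<le>?c. fredholm_term K k p)"
    unfolding fredholm_det_def lessThan_Suc_atMost[symmetric] sum.lessThan_Suc_shift by (simp add: term0)
  also have "\<dots> = (\<Sum>p\<le>?c. \<Sum>T | T \<in> Pow {k..l} \<and> card T = p. (-1) ^ card T * set_det K T)"
    by (simp add: fredholm_term_eq)
  also have "\<dots> = (\<Sum>T\<in>Pow {k..l}. (-1) ^ card T * set_det K T)"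
    using card_mono[OF finite_atLeastAtMost_int[of k l]]
    by (intro sum.group) (auto simp del: card_atLeastAtMost_int)
  also have "\<dots> = set_det (\<lambda>x y. (if x = y then 1 else 0) - K x y) {k..l}"
    by (rule set_det_id_minus[symmetric]) simp
  finally show ?thesis .
qed

end

section \<open>The reduced Aztec diamond\<close>

theorem proposition1p7:
  fixes a :: real and N m k :: nat and \<Sigma>\<^sub>1 \<Sigma>\<^sub>2 :: "real \<Rightarrow> complex"
  assumes "0 < a" and "a \<le> 1"
    and "1 \<le> N"
    and "m \<in> {1..N}"
    and "k \<in> {1..m + 1}"
    and "positive_contour \<Sigma>\<^sub>1"
    and "complex_of_real a \<in> inside (path_image \<Sigma>\<^sub>1)"
    and "- 1 / complex_of_real a \<in> outside (path_image \<Sigma>\<^sub>1)"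
    and "positive_contour \<Sigma>\<^sub>2"
    and "path_image \<Sigma>\<^sub>1 \<subseteq> inside (path_image \<Sigma>\<^sub>2)"
    and "0 \<in> inside (path_image \<Sigma>\<^sub>2)"
  shows "fredholm_convergent (K_aztec a N m \<Sigma>\<^sub>1 \<Sigma>\<^sub>2) (int k) \<and>
    complex_of_real (F_reduced N m k a) =
      complex_of_real (F_aztec N a) * fredholm_det (K_aztec a N m \<Sigma>\<^sub>1 \<Sigma>\<^sub>2) (int k)"
proof -
  let ?c = "complex_of_real a" and ?K = "K_aztec a N m \<Sigma>\<^sub>1 \<Sigma>\<^sub>2" and ?r = "m + 1 - k"
  have m: "1 \<le> m" "m \<le> N" and k: "1 \<le> k" "k \<le> m + 1" using assms by auto
  \<comment> \<open>A decomposition is chosen for every \<open>n'\<close>, because the vanishing of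
    the kernel concerns all columns from \<open>k\<close> on; the bound on the second factor is
    available for \<open>n' \<le> m\<close>, the range of the finite determinant.\<close>
  have "\<forall>n'. \<exists>PQ. [:1, ?c:] ^ m * fst PQ + [:- ?c, 1:] ^ (N - m + 1) * snd PQ = monom 1 (N - m + n') \<and>
      degree (fst PQ) < N - m + 1 \<and> (n' \<le> m \<longrightarrow> degree (snd PQ) < m)"
  proof
    fix n'
    obtain P Q where PQ: "[:1, ?c:] ^ m * P + [:- ?c, 1:] ^ (N - m + 1) * Q = monom 1 (N - m + n')"
      "degree P < N - m + 1"
      "degree (monom 1 (N - m + n') :: complex poly) < m + (N - m + 1) \<Longrightarrow> 1 \<le> m \<Longrightarrow> degree Q < m"
      using partial_fraction[of "N - m + 1" a m "monom 1 (N - m + n')"] by auto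
    moreover have "degree (monom 1 (N - m + n') :: complex poly) < m + (N - m + 1)" if "n' \<le> m"
      using that by (simp add: degree_monom_eq)
    ultimately show "\<exists>PQ. [:1, ?c:] ^ m * fst PQ + [:- ?c, 1:] ^ (N - m + 1) * snd PQ = monom 1 (N - m + n') \<and>
      degree (fst PQ) < N - m + 1 \<and> (n' \<le> m \<longrightarrow> degree (snd PQ) < m)"
      using m by (intro exI[of _ "(P, Q)"]) auto
  qed
  then obtain PQ where PQ: "\<forall>n'. [:1, ?c:] ^ m * fst (PQ n') + [:- ?c, 1:] ^ (N - m + 1) * snd (PQ n')
        = monom 1 (N - m + n') \<and>
      degree (fst (PQ n')) < N - m + 1 \<and> (n' \<le> m \<longrightarrow> degree (snd (PQ n')) < m)"
    by (rule choice[THEN exE])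
  define P Q where "P n' = fst (PQ n')" and "Q n' = snd (PQ n')" for n'
  have P: "[:1, ?c:] ^ m * P n' + [:- ?c, 1:] ^ (N - m + 1) * Q n' = monom 1 (N - m + n')"
    "degree (P n') < N - m + 1" "n' \<le> m \<Longrightarrow> degree (Q n') < m" for n'
    using PQ unfolding P_def Q_def by blast+
  have K: "?K (int n) (int n') = coeff ([:1, ?c:] ^ m * P n') (N - m + n)" for n n'
    by (rule K_aztec_eq_coeff[OF assms(1,6-11) P(1,2)])
  have zero: "?K n n' = 0" if "int m < n" "int k \<le> n'" for n n'
  proof -
    have n: "n = int (nat n)" "n' = int (nat n')" "m < nat n" using that by auto
    \<comment> \<open>The degree is at most \<open>m + (N - m) = N\<close>, while the coefficient
      index \<open>N - m + n\<close> exceeds \<open>N\<close> as soon as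
      \<open>n > m\<close>.\<close>
    have "degree ([:1, ?c:] ^ m * P (nat n')) \<le> m + degree (P (nat n'))"
      using degree_mult_le[of "[:1, ?c:] ^ m" "P (nat n')"] degree_power_le[of "[:1, ?c:]" m]
      by (simp split: if_splits)
    then have "degree ([:1, ?c:] ^ m * P (nat n')) < N - m + nat n"
      using P(2)[of "nat n'"] m n(3) by linarith
    then have "coeff ([:1, ?c:] ^ m * P (nat n')) (N - m + nat n) = 0" by (rule coeff_eq_0)
    then have "?K (int (nat n)) (int (nat n')) = 0" unfolding K .
    then show ?thesis unfolding n(1,2)[symmetric] .
  qed
  have "complex_of_real (F_reduced N m k a) = complex_of_real (F_aztec N a) *
      det (mat ?r ?r (\<lambda>(x, y). (if x = y then 1 else 0) - coeff ([:1, ?c:] ^ m * P (k + x)) (N - m + k + y)))"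
  proof (rule F_reduced_eq_F_aztec_det[OF m k, where P = "\<lambda>x. P (k + x)" and Q = "\<lambda>x. Q (k + x)"])
    fix x assume x: "x < ?r"
    show "[:1, ?c:] ^ m * P (k + x) + [:- ?c, 1:] ^ (N - m + 1) * Q (k + x) = monom 1 (N - m + k + x)"
      using P(1)[of "k + x"] by (simp only: add.assoc)
    show "degree (P (k + x)) \<le> N - m \<and> degree (Q (k + x)) < m"
      using P(2)[of "k + x"] P(3)[of "k + x"] x by simp
  qed
  also have "det (mat ?r ?r (\<lambda>(x, y). (if x = y then 1 else 0) - coeff ([:1, ?c:] ^ m * P (k + x)) (N - m + k + y)))
      = fredholm_det ?K (int k)"
  proof -
    let ?A = "\<lambda>x y. (if x = y then 1 else 0) - ?K x y"
    let ?f = "\<lambda>x. int (k + x)"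
    \<comment> \<open>Rows of the coefficient matrix belong to source monomials, that is to the
      second argument of the kernel; hence the transpose.\<close>
    have "mat ?r ?r (\<lambda>(x, y). (if x = y then 1 else 0) - coeff ([:1, ?c:] ^ m * P (k + x)) (N - m + k + y))
        = transpose_mat (mat ?r ?r (\<lambda>(x, y). ?A (?f x) (?f y)))"
      by (rule eq_matI) (simp_all add: K add.assoc del: of_nat_add)
    moreover have "det (transpose_mat (mat ?r ?r (\<lambda>(x, y). ?A (?f x) (?f y))))
        = det (mat ?r ?r (\<lambda>(x, y). ?A (?f x) (?f y)))"
      by (rule det_transpose[of _ ?r]) simp
    moreover have "det (mat ?r ?r (\<lambda>(x, y). ?A (?f x) (?f y))) = set_det ?A (?f ` {0..<?r})"
      by (rule det_eq_set_det) (simp add: inj_on_def)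
    moreover have "?f ` {0..<?r} = {int k..int m}"
    proof (intro equalityI subsetI)
      fix i assume "i \<in> {int k..int m}"
      then show "i \<in> ?f ` {0..<?r}" by (intro image_eqI[of _ _ "nat i - k"]) auto
    qed auto
    moreover have "fredholm_det ?K (int k) = set_det ?A {int k..int m}"
      using zero by (rule fredholm_det_finite)
    ultimately show ?thesis by simp
  qed
  finally show ?thesis using fredholm_convergent_finite[of "int m" "int k" ?K] zero by blast
qed

end
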